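(* Let $G=(V,E)$ be a finite connected graph with girth at least $6$, with $E=\{e_1,\dots,e_n\}$, and let $\kappa^*=(\kappa_1^*,\dots,\kappa_n^* )\in\mathbb{R}^n$ be a prescribed curvature satisfying the topological condition $\sum_{i=1}^n\kappa_i^*=2(|V|-|E|)$. Then the following statements are equivalent: (i) There exists a weight $r^*$ such that $\kappa(r^* )=\kappa^*$. (ii) The solution $r(t)$ to the modified Calabi flow $\frac{d}{dt}r_i=\Delta(\kappa-\kappa^* )_i$, $r_i(0)=r_{0,i}$, exists for all times and converges exponentially fast to $r^*$. (iii) For any $s\in\mathbb{R}$, the solution $r(t)$ to the $2s$-th order fractional Calabi flow $\frac{d}{dt}r_i=\Delta^s(\kappa-\kappa^* )_i$, $r_i(0)=r_{0,i}$, exists for all time and converges exponentially fast to $r^*$. (iv) For any $p>1$, the solution $r(t)$ to the $p$-th Calabi flow $\frac{d}{dt}r_i=\Delta_p(\kappa-\kappa^* )_i$, $r_i(0)=r_{0,i}$, exists for all time and converges to $r^*$.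
   Context: Girth at least $6$ means that the graph has no cycles of length $3$, $4$ or $5$. A weight is a positive function $\omega:E\to\mathbb{R}_{+}$, $\omega_i=\omega(e_i)$, parametrized by $r_i=\ln\omega_i$, $r=(r_1,\dots,r_n)\in\mathbb{R}^n$ (the vector $r$ is also called a weight); $r_0=(r_{0,1},\dots,r_{0,n})\in\mathbb{R}^n$ is the initial value of the flows. For $x\in V$ let $m(x)=\sum_{y\sim x}\omega_{xy}$ be the total weight of the edges incident to $x$. The (Lin-Lu-Yau) curvature of an edge $e$ with endpoints $x,y$ is $$\kappa_e=2\omega_e\Big(\frac1{m(x)}+\frac1{m(y)}\Big)-2,$$ and $\kappa=\kappa(r)=(\kappa_1,\dots,\kappa_n)$ with $\kappa_i=\kappa_{e_i}$, regarded as a function of $r$. Let $J=J(r)=\big(\frac{\partial\kappa_i}{\partial r_j}\big)_{n\times n}$; it is symmetric and positive semi-definite. The following operators depend on $r$ and act on functions $g:E\to\mathbb{R}$ (vectors in $\mathbb{R}^n$): - Discrete Laplace operator: $\Delta g_i=-\sum_{j=1}^n\frac{\partial\kappa_i}{\partial r_j}g_j$, i.e. $\Delta=-J$. - Fractional discrete Laplace operator, $s\in\mathbb{R}$: $\Delta^s=-J^s$, where, if $J=Q^{\mathrm T}\operatorname{diag}\{\lambda_1,\dots,\lambda_n\}Q$ with $Q$ orthogonal, $J^s=Q^{\mathrm T}\operatorname{diag}\{\lambda_1^s,\dots,\lambda_n^s\}Q$, with the convention $0^s=0$ for all $s\in\mathbb{R}$. - Discrete $p$-Laplacian, $p>1$: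 $\Delta_p g_i=\sum_{j\sim i}\big(-\frac{\partial\kappa_i}{\partial r_j}\big)|g_j-g_i|^{p-2}(g_j-g_i)$, where $j\sim i$ means that the distinct edges $e_i,e_j$ are adjacent (share a vertex), and $|a|^{p-2}a$ is read as $0$ when $a=0$. In the flows, the operators and $\kappa$ are evaluated at $r=r(t)$, and convergence is as $t\to\infty$. Exponentially fast convergence to $r^*$ means $\|r(t)-r^*\|\le Ce^{-\lambda t}$ for all $t\ge 0$, for some constants $C,\lambda>0$. *)

theory Defs
  imports "HOL-Analysis.Analysis"
begin

section \<open>Graphs\<close>

definition simple_graph :: "'v set \<Rightarrow> 'v set set \<Rightarrow> bool" where
  "simple_graph V E \<longleftrightarrow> finite V \<and> (\<forall>e\<in>E. e \<subseteq> V \<and> card e = 2)"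

definition connected_graph :: "'v set \<Rightarrow> 'v set set \<Rightarrow> bool" where
  "connected_graph V E \<longleftrightarrow>
     V \<noteq> {} \<and> (\<forall>x\<in>V. \<forall>y\<in>V. (x, y) \<in> {(u, v). {u, v} \<in> E}\<^sup>*)"

text \<open>The list gives the vertices of the cycle in cyclic order. Only used for \<open>k \<ge> 3\<close>;
  for \<open>k = 2\<close> a single edge would qualify.\<close>

definition has_cycle :: "'v set set \<Rightarrow> nat \<Rightarrow> bool" where
  "has_cycle E k \<longleftrightarrow>
     (\<exists>vs. length vs = k \<and> distinct vs \<and> (\<forall>i<k. {vs ! i, vs ! (Suc i mod k)} \<in> E))"

definition girth_at_least_6 :: "'v set set \<Rightarrow> bool" where
  "girth_at_least_6 E \<longleftrightarrow> (\<forall>k\<in>{3, 4, 5}. \<not> has_cycle E k)"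


section \<open>Weights and curvature\<close>

text \<open>The edges are enumerated by a bijection \<open>e\<close> from the finite index type \<open>'n\<close> onto \<open>E\<close>.
  A weight is given by \<open>r :: real^'n\<close>, the edge \<open>e i\<close> having weight \<open>exp (r $ i)\<close>.\<close>

definition vertex_weight :: "('n::finite \<Rightarrow> 'v set) \<Rightarrow> real^'n \<Rightarrow> 'v \<Rightarrow> real" where
  "vertex_weight e r x = (\<Sum>i | x \<in> e i. exp (r $ i))"

definition curvature :: "('n::finite \<Rightarrow> 'v set) \<Rightarrow> real^'n \<Rightarrow> real^'n" where
  "curvature e r = (\<chi> i. 2 * exp (r $ i) * (\<Sum>x\<in>e i. 1 / vertex_weight e r x) - 2)"

definition J :: "('n::finite \<Rightarrow> 'v set) \<Rightarrow> real^'n \<Rightarrow> real^'n^'n" where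
  "J e r = jacobian (curvature e) (at r)"


section \<open>Laplace operators\<close>

definition laplace :: "('n::finite \<Rightarrow> 'v set) \<Rightarrow> real^'n \<Rightarrow> real^'n \<Rightarrow> real^'n" where
  "laplace e r g = - (J e r *v g)"

definition diag_matrix :: "real^'n \<Rightarrow> real^'n^'n" where
  "diag_matrix d = (\<chi> i j. if i = j then d $ i else 0)"

text \<open>For a positive semi-definite matrix; \<open>0 powr s = 0\<close> for every \<open>s\<close>, including
  \<open>s \<le> 0\<close>. The result does not depend on the diagonalization.\<close>

definition matrix_powr :: "real^'n^'n \<Rightarrow> real \<Rightarrow> real^'n^'n::finite" where
  "matrix_powr A s = (THE B. \<exists>Q d. orthogonal_matrix Q \<and>
     A = transpose Q ** diag_matrix d ** Q \<and>
     B = transpose Q ** diag_matrix (\<chi> i. (d $ i) powr s) ** Q)"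

definition frac_laplace ::
    "('n::finite \<Rightarrow> 'v set) \<Rightarrow> real \<Rightarrow> real^'n \<Rightarrow> real^'n \<Rightarrow> real^'n" where
  "frac_laplace e s r g = - (matrix_powr (J e r) s *v g)"

definition p_laplace ::
    "('n::finite \<Rightarrow> 'v set) \<Rightarrow> real \<Rightarrow> real^'n \<Rightarrow> real^'n \<Rightarrow> real^'n" where
  "p_laplace e p r g = (\<chi> i. \<Sum>j | j \<noteq> i \<and> e j \<inter> e i \<noteq> {}.
     (- (J e r $ i $ j)) * (\<bar>g $ j - g $ i\<bar> powr (p - 2) * (g $ j - g $ i)))"


section \<open>Flows\<close>

text \<open>Global solution on \<open>[0, \<infinity>)\<close> of \<open>r' = F r\<close>, \<open>r 0 = r0\<close>.\<close>

definition flow_solution ::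
    "(real^'n \<Rightarrow> real^'n) \<Rightarrow> real^'n \<Rightarrow> (real \<Rightarrow> real^'n::finite) \<Rightarrow> bool" where
  "flow_solution F r0 r \<longleftrightarrow> r 0 = r0 \<and>
     (\<forall>t\<ge>0. (r has_vector_derivative F (r t)) (at t within {0..}))"

text \<open>``The solution exists for all time and converges'': a global solution exists and
  every global solution converges. This does not presuppose uniqueness, which is not
  immediate for the \<open>p\<close>-Laplacian with \<open>p < 2\<close>, where the right-hand side need not be
  locally Lipschitz.\<close>

definition flow_converges ::
    "(real^'n \<Rightarrow> real^'n) \<Rightarrow> real^'n \<Rightarrow> real^'n::finite \<Rightarrow> bool" where
  "flow_converges F r0 rstar \<longleftrightarrow> (\<exists>r. flow_solution F r0 r) \<and>
     (\<forall>r. flow_solution F r0 r \<longrightarrow> (r \<longlongrightarrow> rstar) at_top)"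

definition flow_converges_exp ::
    "(real^'n \<Rightarrow> real^'n) \<Rightarrow> real^'n \<Rightarrow> real^'n::finite \<Rightarrow> bool" where
  "flow_converges_exp F r0 rstar \<longleftrightarrow> (\<exists>r. flow_solution F r0 r) \<and>
     (\<forall>r. flow_solution F r0 r \<longrightarrow>
        (\<exists>C>0. \<exists>l>0. \<forall>t\<ge>0. norm (r t - rstar) \<le> C * exp (- l * t)))"

definition calabi_field :: "('n::finite \<Rightarrow> 'v set) \<Rightarrow> real^'n \<Rightarrow> real^'n \<Rightarrow> real^'n" where
  "calabi_field e k r = laplace e r (curvature e r - k)"

definition frac_calabi_field ::
    "('n::finite \<Rightarrow> 'v set) \<Rightarrow> real^'n \<Rightarrow> real \<Rightarrow> real^'n \<Rightarrow> real^'n" where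
  "frac_calabi_field e k s r = frac_laplace e s r (curvature e r - k)"

definition p_calabi_field ::
    "('n::finite \<Rightarrow> 'v set) \<Rightarrow> real^'n \<Rightarrow> real \<Rightarrow> real^'n \<Rightarrow> real^'n" where
  "p_calabi_field e k p r = p_laplace e p r (curvature e r - k)"

end

theory Submission
  imports Defs
begin

text \<open>The curvature defect \<open>\<kappa> - \<kappa>*\<close> is the gradient of the potential
  \<open>\<psi> r = 2 (\<Sum>x\<in>V. ln (m x)) - (\<Sum>i. (2 + \<kappa>* i) r i)\<close>, whose Hessian \<open>J\<close> is a weighted graph
  Laplacian on the line graph: it is positive definite transversally to the constant vectors. By the
  Gauss-Bonnet formula \<open>\<kappa> - \<kappa>*\<close> has vanishing sum, so all three fields \<open>X\<close> satisfy
  \<open>(\<kappa> - \<kappa>*) \<bullet> X < 0\<close> off the zeros of \<open>\<kappa> - \<kappa>*\<close>, and each flow preserves the sum of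
  \<open>r\<close>. If \<open>\<kappa> r* = \<kappa>*\<close>, shift \<open>r*\<close> along the constants to the sum of \<open>r0\<close>; then
  \<open>\<psi>\<close> is coercive on that hyperplane with unique minimum \<open>r*\<close> and decreases along the flow, which
  gives compactness and convergence, and with strong convexity on compact sets an exponential rate for
  the linear operators. Conversely, a limit of a solution is a zero of the field, hence of
  \<open>\<kappa> - \<kappa>*\<close>. The fields are only known to be continuous, so solutions come from Peano's theorem.\<close>

section \<open>Peano's existence theorem\<close>

text \<open>Two difficulties shape the argument. First, the fields are irregular: for
  \<open>p < 2\<close> the map \<open>|t| powr (p - 2) * t\<close> is not Lipschitz at 0, and for
  \<open>s \<le> 0\<close> the function \<open>t powr s\<close> jumps at 0, so continuity of the
  powers of \<open>J\<close> in \<open>r\<close> rests on the kernel of \<open>J\<close> being the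
  same line for every \<open>r\<close>. Second, uniqueness of solutions is not established, so
  convergence has to be shown for every global solution. The a priori bound therefore comes from the
  energy alone and holds for any field that is tangent to the hyperplane and dissipative. It serves
  existence as well, since Peano's theorem wants a bounded field and the bound applies equally to a
  truncated one. The energy argument sees a field only through its pairing with the gradient, so the
  limit does not depend on the operator: it is fixed by the sum of \<open>r0\<close>, and a single
  weight serves all \<open>s\<close> and all \<open>p\<close>. The modified Calabi flow is the case
  \<open>s = 1\<close>.\<close>

primrec euler :: "('a::real_vector \<Rightarrow> 'a) \<Rightarrow> 'a \<Rightarrow> real \<Rightarrow> nat \<Rightarrow> 'a" where
  "euler F x0 h 0 = x0"
| "euler F x0 h (Suc j) = euler F x0 h j + h *\<^sub>R F (euler F x0 h j)"

text \<open>Each step adds \<open>h *\<^sub>R F x\<close>, which differs from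
  \<open>h *\<^sub>R v\<close> by at most \<open>h * \<epsilon>\<close>. With \<open>v = 0\<close>
  this is a Lipschitz bound; with \<open>v\<close> the field at a limit point it is the difference
  quotient estimate that passes to the limit, so no integral equation is needed.\<close>

lemma euler_increment:
  fixes F :: "'a::real_normed_vector \<Rightarrow> 'a"
  assumes "l \<le> m" "0 \<le> h"
    and "\<And>j. l \<le> j \<Longrightarrow> j < m \<Longrightarrow> norm (F (euler F x0 h j) - v) \<le> \<epsilon>"
  shows "norm (euler F x0 h m - euler F x0 h l - (real (m - l) * h) *\<^sub>R v) \<le> real (m - l) * h * \<epsilon>"
  using assms(1,3)
proof (induction m rule: dec_induct)
  case base
  then show ?case by simp
next
  case (step n)
  let ?x = "euler F x0 h"
  have IH: "norm (?x n - ?x l - (real (n - l) * h) *\<^sub>R v) \<le> real (n - l) * h * \<epsilon>"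
    using step by auto
  have "norm (h *\<^sub>R (F (?x n) - v)) \<le> h * \<epsilon>"
    using step.prems[of n] step.hyps assms(2) by (simp add: mult_left_mono)
  moreover have "?x (Suc n) - ?x l - (real (Suc n - l) * h) *\<^sub>R v
      = (?x n - ?x l - (real (n - l) * h) *\<^sub>R v) + h *\<^sub>R (F (?x n) - v)"
    using step.hyps by (simp add: Suc_diff_le algebra_simps)
  ultimately have "norm (?x (Suc n) - ?x l - (real (Suc n - l) * h) *\<^sub>R v)
      \<le> real (n - l) * h * \<epsilon> + h * \<epsilon>"
    using IH by (metis norm_triangle_mono)
  then show ?case
    using step.hyps by (simp add: Suc_diff_le algebra_simps)
qed

lemma euler_lipschitz:
  fixes F :: "'a::real_normed_vector \<Rightarrow> 'a"
  assumes "0 \<le> h" and "\<And>x. norm (F x) \<le> M"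
  shows "norm (euler F x0 h m - euler F x0 h l) \<le> \<bar>real m - real l\<bar> * h * M"
proof (induction m l rule: linorder_wlog)
  case (le l m)
  then show ?case
    using euler_increment[of l m h F x0 0 M] assms by (simp add: norm_minus_commute of_nat_diff)
next
  case (sym l m)
  then show ?case by (simp add: norm_minus_commute abs_minus_commute)
qed

text \<open>Tychonoff in place of a diagonal subsequence: all \<open>f k\<close> lie in a compact
  product of closures, so they have a cluster point \<open>g\<close> in the product topology.
  Convergence is along a filter finer than \<open>sequentially\<close>, which is all that passing to
  limits in inequalities requires.\<close>

lemma pointwise_cluster_filter:
  fixes f :: "nat \<Rightarrow> 'b \<Rightarrow> 'a::heine_borel"
  assumes "\<And>t. bounded (range (\<lambda>k. f k t))"
  obtains G g where "G \<le> sequentially" "G \<noteq> bot" "\<And>t. ((\<lambda>k. f k t) \<longlongrightarrow> g t) G"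
proof -
  define C where "C = (\<lambda>t. closure (range (\<lambda>k. f k t)))"
  have "compact (C t)" for t
    unfolding C_def using assms by (simp add: compact_closure)
  then have "compactin (product_topology (\<lambda>i. euclidean) UNIV) (PiE UNIV C)"
    by (simp add: compactin_PiE)
  then have cpt: "compact (PiE UNIV C)"
    by (simp add: euclidean_product_topology)
  have mem: "f k \<in> PiE UNIV C" for k
    unfolding C_def using closure_subset by fastforce
  have "filtermap f sequentially \<noteq> bot" "eventually (\<lambda>x. x \<in> PiE UNIV C) (filtermap f sequentially)"
    using mem by (auto simp: filtermap_bot_iff eventually_filtermap)
  then obtain g where g: "inf (nhds g) (filtermap f sequentially) \<noteq> bot"
    using cpt unfolding compact_filter by blast
  \<comment> \<open>The coarsest refinement of \<open>sequentially\<close> along which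
    \<open>f\<close> tends to \<open>g\<close>; it is proper precisely because \<open>g\<close> is a
    cluster point.\<close>
  define G where "G = inf sequentially (filtercomap f (nhds g))"
  show thesis
  proof
    show "G \<le> sequentially" by (simp add: G_def)
    show "G \<noteq> bot"
    proof
      assume "G = bot"
      then have "eventually (\<lambda>_. False) G" by simp
      then obtain P Q where P: "eventually P sequentially" and Q: "eventually Q (filtercomap f (nhds g))"
        and PQ: "\<And>k. P k \<Longrightarrow> Q k \<Longrightarrow> False"
        unfolding G_def eventually_inf by blast
      from Q obtain R where R: "eventually R (nhds g)" "\<And>k. R (f k) \<Longrightarrow> Q k"
        by (auto simp: eventually_filtercomap)
      have "eventually (\<lambda>y. \<not> R y) (filtermap f sequentially)"
        unfolding eventually_filtermap using P by eventually_elim (use PQ R in blast)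
      with R(1) have "eventually (\<lambda>_. False) (inf (nhds g) (filtermap f sequentially))"
        unfolding eventually_inf by blast
      with g show False by (simp add: eventually_False)
    qed
    show "((\<lambda>k. f k t) \<longlongrightarrow> g t) G" for t
    proof -
      have "filterlim f (nhds g) G"
        unfolding G_def by (meson filterlim_filtercomap filterlim_mono inf_le2 order_refl)
      moreover have "open ((\<lambda>y. y t) -` S)" if "open S" for S :: "'a set"
        by (intro open_vimage that continuous_on_product_coordinates)
      ultimately have "eventually (\<lambda>k. f k \<in> (\<lambda>y. y t) -` S) G"
        if "open S" "g t \<in> S" for S :: "'a set"
        using that by (intro topological_tendstoD[of f g G]) auto
      then show ?thesis by (auto intro: topological_tendstoI)
    qed
  qed
qed

lemma grid_point:
  fixes t h :: real
  assumes "0 < h" "0 \<le> t"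
  shows "real (nat \<lfloor>t / h\<rfloor>) * h \<le> t" and "t < real (nat \<lfloor>t / h\<rfloor>) * h + h"
proof -
  have "real (nat \<lfloor>t / h\<rfloor>) = of_int \<lfloor>t / h\<rfloor>"
    using assms by simp
  moreover have "of_int \<lfloor>t / h\<rfloor> \<le> t / h" "t / h < of_int \<lfloor>t / h\<rfloor> + 1"
    by linarith+
  ultimately show "real (nat \<lfloor>t / h\<rfloor>) * h \<le> t" "t < real (nat \<lfloor>t / h\<rfloor>) * h + h"
    using pos_le_divide_eq[OF assms(1)] pos_divide_less_eq[OF assms(1)]
    by (simp_all only: distrib_right mult_1)
qed

text \<open>Forward Euler schemes with step \<open>1 / (k + 1)\<close>, read as step functions of
  time. The bound \<open>M\<close> makes them Lipschitz up to one step, uniformly in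
  \<open>k\<close>; this gives pointwise boundedness, and it keeps the scheme near
  \<open>r t0\<close> at times near \<open>t0\<close>.\<close>

theorem peano_bounded:
  fixes F :: "'a::{real_normed_vector,heine_borel} \<Rightarrow> 'a"
  assumes contF: "continuous_on UNIV F" and bdd: "\<And>x. norm (F x) \<le> M"
  obtains r where "r 0 = x0"
    and "\<And>t. 0 \<le> t \<Longrightarrow> (r has_vector_derivative F (r t)) (at t within {0..})"
proof -
  define h where "h = (\<lambda>k::nat. 1 / real (Suc k))"
  \<comment> \<open>Index of the last grid point not after \<open>t\<close>. Negative times give 0
    through \<open>nat\<close>, so the pointwise bound holds for every real
    \<open>t\<close>.\<close>
  define N where "N = (\<lambda>k (t::real). nat \<lfloor>t / h k\<rfloor>)"
  define X where "X = (\<lambda>k. euler F x0 (h k))"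
  have h: "0 < h k" for k by (simp add: h_def)
  have M0: "0 \<le> M" using bdd[of x0] norm_ge_zero order_trans by blast
  have N: "real (N k t) * h k \<le> t" "t < real (N k t) * h k + h k" if "0 \<le> t" for k t
    unfolding N_def using grid_point[OF h that] by auto
  have N0: "N k t = 0" if "t \<le> 0" for k t
    unfolding N_def using divide_nonpos_pos[OF that h[of k]] by simp
  have hlim: "h \<longlonglongrightarrow> 0"
    unfolding h_def using LIMSEQ_inverse_real_of_nat by (simp add: inverse_eq_divide)
  have XL: "norm (X k m - X k l) \<le> \<bar>real m - real l\<bar> * h k * M" for k m l
    unfolding X_def using euler_lipschitz h bdd less_imp_le by metis
  have "bounded (range (\<lambda>k. X k (N k t)))" for t
  proof -
    have "norm (X k (N k t) - x0) \<le> max 0 t * M" for k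
    proof -
      have "norm (X k (N k t) - x0) \<le> real (N k t) * h k * M"
        using XL[of k "N k t" 0] by (simp add: X_def)
      also have "\<dots> \<le> max 0 t * M"
        using N[of t k] N0[of t k] M0 by (intro mult_right_mono) (cases "t \<le> 0"; auto)+
      finally show ?thesis .
    qed
    then have "range (\<lambda>k. X k (N k t)) \<subseteq> cball x0 (max 0 t * M)"
      by (auto simp: dist_norm norm_minus_commute)
    then show ?thesis using bounded_cball bounded_subset by blast
  qed
  then obtain G r where G: "G \<le> sequentially" "G \<noteq> bot"
    and lim: "\<And>t. ((\<lambda>k. X k (N k t)) \<longlongrightarrow> r t) G"
    using pointwise_cluster_filter[of "\<lambda>k t. X k (N k t)"] by blast
  have hG: "(h \<longlongrightarrow> 0) G" using hlim G(1) filterlim_mono by blast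
  have gridlim: "((\<lambda>k. real (N k t) * h k) \<longlongrightarrow> t) G" if "0 \<le> t" for t
  proof (rule tendsto_sandwich[where f = "\<lambda>k. t - h k" and h = "\<lambda>_. t"])
    show "((\<lambda>k. t - h k) \<longlongrightarrow> t) G" using tendsto_diff[OF tendsto_const hG] by simp
    show "eventually (\<lambda>k. t - h k \<le> real (N k t) * h k) G"
    proof (intro always_eventually allI)
      show "t - h k \<le> real (N k t) * h k" for k using N(2)[OF that, of k] by linarith
    qed
    show "eventually (\<lambda>k. real (N k t) * h k \<le> t) G"
      using N(1)[OF that] by (intro always_eventually allI)
  qed simp
  \<comment> \<open>The field is frozen at \<open>t0\<close> while \<open>s\<close> and
    \<open>t\<close> vary on both sides of it: \<open>s = t0\<close> then yields the right
    derivative and \<open>t = t0\<close> the left one.\<close>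
  have key: "\<exists>\<eta>>0. \<forall>s\<ge>0. \<forall>t\<ge>s. t0 - \<eta> \<le> s \<longrightarrow> t \<le> t0 + \<eta> \<longrightarrow>
      norm (r t - r s - (t - s) *\<^sub>R F (r t0)) \<le> \<epsilon> * (t - s)" if "0 < \<epsilon>" "0 \<le> t0" for \<epsilon> t0
  proof -
    obtain \<delta> where \<delta>: "0 < \<delta>" "\<And>y. norm (y - r t0) < \<delta> \<Longrightarrow> norm (F y - F (r t0)) < \<epsilon>"
      using contF \<open>0 < \<epsilon>\<close> unfolding continuous_on_iff dist_norm by (metis UNIV_I)
    \<comment> \<open>Moving for time \<open>\<eta>\<close> costs at most
      \<open>\<delta> / 4\<close>, rounding to the grid another \<open>\<delta> / 4\<close>, and the
      distance from the scheme at \<open>t0\<close> to \<open>r t0\<close> a third, so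
      \<open>F\<close> is evaluated within \<open>\<delta>\<close> of \<open>r t0\<close>. The
      summand 1 covers \<open>M = 0\<close>.\<close>
    define \<eta> where "\<eta> = \<delta> / (4 * (M + 1))"
    have \<eta>: "0 < \<eta>" "\<eta> * M < \<delta> / 4"
      using \<delta>(1) M0 by (auto simp: \<eta>_def field_simps)
    have "norm (r t - r s - (t - s) *\<^sub>R F (r t0)) \<le> \<epsilon> * (t - s)"
      if st: "0 \<le> s" "s \<le> t" "t0 - \<eta> \<le> s" "t \<le> t0 + \<eta>" for s t
    proof (rule tendsto_le[OF G(2)])
      let ?g = "\<lambda>k. real (N k t) * h k - real (N k s) * h k"
      have "0 \<le> t" using st by simp
      have glim: "(?g \<longlongrightarrow> t - s) G"
        by (intro tendsto_diff gridlim st \<open>0 \<le> t\<close>)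
      show "((\<lambda>k. \<epsilon> * ?g k) \<longlongrightarrow> \<epsilon> * (t - s)) G"
        by (intro tendsto_intros glim)
      show "((\<lambda>k. norm (X k (N k t) - X k (N k s) - ?g k *\<^sub>R F (r t0))) \<longlongrightarrow>
          norm (r t - r s - (t - s) *\<^sub>R F (r t0))) G"
        by (intro tendsto_intros glim lim)
      have "eventually (\<lambda>k. dist (X k (N k t0)) (r t0) < \<delta> / 4) G"
        using lim[of t0] \<delta>(1) by (intro tendstoD) auto
      moreover have "eventually (\<lambda>k. dist (h k) 0 < \<delta> / (4 * (M + 1))) G"
        using hG \<delta>(1) M0 by (intro tendstoD) auto
      ultimately show "eventually (\<lambda>k. norm (X k (N k t) - X k (N k s) - ?g k *\<^sub>R F (r t0)) \<le> \<epsilon> * ?g k) G"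
      proof eventually_elim
        case (elim k)
        have hM: "h k * M < \<delta> / 4"
        proof -
          have "h k < \<eta>" using elim(2) h[of k] by (simp add: \<eta>_def)
          then have "h k * M \<le> \<eta> * M" using M0 by (intro mult_right_mono) auto
          then show ?thesis using \<eta>(2) by simp
        qed
        have le: "N k s \<le> N k t"
          unfolding N_def using st h[of k] by (intro nat_mono floor_mono divide_right_mono) auto
        have close: "norm (F (X k j) - F (r t0)) \<le> \<epsilon>" if j: "N k s \<le> j" "j < N k t" for j
        proof -
          have "real (N k s) * h k \<le> real j * h k" "real j * h k \<le> real (N k t) * h k"
            using j h[of k] by (auto intro!: mult_right_mono)
          then have "s - h k \<le> real j * h k" "real j * h k \<le> t"
            using N[of s k] N[of t k] st \<open>0 \<le> t\<close> by linarith+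
          then have "\<bar>real j * h k - real (N k t0) * h k\<bar> \<le> \<eta> + h k"
            using N[of t0 k] \<open>0 \<le> t0\<close> st by linarith
          then have "\<bar>real j - real (N k t0)\<bar> * h k \<le> \<eta> + h k"
            using h[of k] by (simp add: left_diff_distrib[symmetric] abs_mult)
          then have "\<bar>real j - real (N k t0)\<bar> * h k * M \<le> (\<eta> + h k) * M"
            using M0 by (rule mult_right_mono)
          then have "norm (X k j - X k (N k t0)) \<le> \<eta> * M + h k * M"
            using XL[of k j "N k t0"] by (simp add: algebra_simps)
          then have "norm (X k j - r t0) < \<delta>"
            using elim(1) hM \<eta>(2) \<delta>(1) norm_triangle_ineq[of "X k j - X k (N k t0)" "X k (N k t0) - r t0"]
            by (simp add: dist_norm)
          then show ?thesis using \<delta>(2) less_imp_le by blast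
        qed
        show ?case
          using euler_increment[of "N k s" "N k t" "h k" F x0 "F (r t0)" \<epsilon>] le h[of k] close
          by (simp add: X_def of_nat_diff algebra_simps)
      qed
    qed
    then show ?thesis using \<eta>(1) by blast
  qed
  show thesis
  proof
    have "(\<lambda>k. X k (N k 0)) = (\<lambda>_. x0)" by (simp add: N0 X_def)
    then show "r 0 = x0" using tendsto_unique[OF G(2) lim[of 0]] by simp
    show "(r has_vector_derivative F (r t)) (at t within {0..})" if "0 \<le> t" for t
      unfolding has_vector_derivative_def has_derivative_within_alt
    proof (intro conjI allI impI)
      show "bounded_linear (\<lambda>x. x *\<^sub>R F (r t))" by (rule bounded_linear_scaleR_left)
      fix \<epsilon> :: real assume "0 < \<epsilon>"
      from key[OF this that] obtain \<eta> where \<eta>: "0 < \<eta>" "\<forall>s\<ge>0. \<forall>t'\<ge>s. t - \<eta> \<le> s \<longrightarrow> t' \<le> t + \<eta> \<longrightarrow>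
        norm (r t' - r s - (t' - s) *\<^sub>R F (r t)) \<le> \<epsilon> * (t' - s)" by blast
      have "norm (r y - r t - (y - t) *\<^sub>R F (r t)) \<le> \<epsilon> * norm (y - t)"
        if y: "0 \<le> y" "norm (y - t) < \<eta>" for y
      proof (cases "t \<le> y")
        case True
        then show ?thesis using \<eta>(2)[rule_format, of t y] y \<open>0 \<le> t\<close> \<eta>(1) by simp
      next
        case False
        have "r y - r t - (y - t) *\<^sub>R F (r t) = - (r t - r y - (t - y) *\<^sub>R F (r t))"
          by (simp add: algebra_simps)
        then show ?thesis using \<eta>(2)[rule_format, of y t] y False \<eta>(1)
          by (simp only: norm_minus_cancel) (simp add: abs_minus_commute)
      qed
      then show "\<exists>d>0. \<forall>y\<in>{0..}. norm (y - t) < d \<longrightarrow>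
          norm (r y - r t - (y - t) *\<^sub>R F (r t)) \<le> \<epsilon> * norm (y - t)"
        using \<eta>(1) by auto
    qed
  qed
qed

section \<open>Dissipative flows of a convex potential\<close>

text \<open>Mean value theorem with derivatives taken within \<open>{0..}\<close>, as
  \<open>flow_solution\<close> provides them, so that the one-sided derivative at time 0 is
  included. No continuity of \<open>f'\<close> is asked for.\<close>

lemma increment_upper_bound:
  fixes f :: "real \<Rightarrow> real"
  assumes "\<And>x. s \<le> x \<Longrightarrow> x \<le> t \<Longrightarrow> (f has_real_derivative f' x) (at x within {0..})"
    and "\<And>x. s \<le> x \<Longrightarrow> x \<le> t \<Longrightarrow> f' x \<le> m" and "0 \<le> s" "s \<le> t"
  shows "f t - f s \<le> m * (t - s)"
proof -
  have "(f has_derivative (\<lambda>h. f' x * h)) (at x within {s..t})" if "s \<le> x" "x \<le> t" for x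
  proof -
    have "(f has_real_derivative f' x) (at x within {s..t})"
      using assms(1)[OF that] by (rule has_field_derivative_subset) (use \<open>0 \<le> s\<close> in auto)
    then show ?thesis by (simp add: has_field_derivative_def)
  qed
  from mvt_very_simple[OF \<open>s \<le> t\<close> this]
  obtain x where "x \<in> {s..t}" "f t - f s = f' x * (t - s)" by blast
  then show ?thesis using assms(2)[of x] \<open>s \<le> t\<close> by (simp add: mult_right_mono)
qed

lemma increment_lower_bound:
  fixes f :: "real \<Rightarrow> real"
  assumes "\<And>x. s \<le> x \<Longrightarrow> x \<le> t \<Longrightarrow> (f has_real_derivative f' x) (at x within {0..})"
    and "\<And>x. s \<le> x \<Longrightarrow> x \<le> t \<Longrightarrow> m \<le> f' x" and "0 \<le> s" "s \<le> t"
  shows "m * (t - s) \<le> f t - f s"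
proof -
  have "- f t - - f s \<le> - m * (t - s)"
    by (rule increment_upper_bound[where f' = "\<lambda>x. - f' x"])
      (use assms in \<open>auto intro: DERIV_minus\<close>)
  then show ?thesis by simp
qed

lemma flow_solution_chain:
  assumes "flow_solution X r0 r" "0 \<le> t" and \<phi>: "(\<phi> has_derivative \<phi>') (at (r t))"
  shows "((\<lambda>t. \<phi> (r t)) has_real_derivative \<phi>' (X (r t))) (at t within {0..})"
proof -
  have "(r has_derivative (\<lambda>x. x *\<^sub>R X (r t))) (at t within {0..})"
    using assms by (simp add: flow_solution_def has_vector_derivative_def)
  then have "((\<lambda>t. \<phi> (r t)) has_derivative (\<lambda>x. \<phi>' (x *\<^sub>R X (r t)))) (at t within {0..})"
    using \<phi> by (rule has_derivative_compose)
  moreover have "\<phi>' (x *\<^sub>R X (r t)) = \<phi>' (X (r t)) * x" for x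
    using has_derivative_linear[OF \<phi>] by (simp add: linear_scale)
  ultimately show ?thesis by (simp add: has_field_derivative_def)
qed

text \<open>If \<open>w = X a\<close> were nonzero, the component of \<open>r\<close> along
  \<open>w\<close> would eventually grow at rate at least \<open>w \<bullet> w / 2\<close>. Over
  unit time intervals this contradicts convergence, which forces the increments to 0.\<close>

lemma flow_limit_stationary:
  assumes sol: "flow_solution X r0 r" and lim: "(r \<longlongrightarrow> a) at_top" and cont: "isCont X a"
  shows "X a = 0"
proof (rule ccontr)
  assume "X a \<noteq> 0"
  define w where "w = X a"
  have w: "0 < w \<bullet> w" using \<open>X a \<noteq> 0\<close> by (simp add: w_def)
  have "((\<lambda>t. X (r t) \<bullet> w) \<longlongrightarrow> w \<bullet> w) at_top"
    unfolding w_def by (intro tendsto_intros isCont_tendsto_compose[OF cont] lim)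
  then have "eventually (\<lambda>t. w \<bullet> w / 2 < X (r t) \<bullet> w) at_top"
    by (rule order_tendstoD) (use w in simp)
  then obtain T where T: "\<And>t. T \<le> t \<Longrightarrow> w \<bullet> w / 2 < X (r t) \<bullet> w"
    by (auto simp: eventually_at_top_linorder)
  have "((\<lambda>t. r (t + 1)) \<longlongrightarrow> a) at_top"
    by (rule filterlim_compose[OF lim])
      (intro filterlim_tendsto_add_at_top[OF tendsto_const, of "\<lambda>x. x" at_top "1::real",
        simplified add.commute] filterlim_ident)
  then have "((\<lambda>t. r (t + 1) \<bullet> w - r t \<bullet> w) \<longlongrightarrow> a \<bullet> w - a \<bullet> w) at_top"
    using lim by (intro tendsto_intros)
  then have "eventually (\<lambda>t. r (t + 1) \<bullet> w - r t \<bullet> w < w \<bullet> w / 2) at_top"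
    by (rule order_tendstoD) (use w in simp)
  then have "eventually (\<lambda>t. r (t + 1) \<bullet> w - r t \<bullet> w < w \<bullet> w / 2 \<and> max 0 T \<le> t) at_top"
    by (intro eventually_conj eventually_ge_at_top)
  then obtain t where t: "r (t + 1) \<bullet> w - r t \<bullet> w < w \<bullet> w / 2" "0 \<le> t" "T \<le> t"
    by (auto simp: eventually_at_top_linorder)
  have "w \<bullet> w / 2 * (t + 1 - t) \<le> r (t + 1) \<bullet> w - r t \<bullet> w"
  proof (rule increment_lower_bound)
    fix x assume x: "t \<le> x"
    show "((\<lambda>t. r t \<bullet> w) has_real_derivative X (r x) \<bullet> w) (at x within {0..})"
      by (rule flow_solution_chain[OF sol, where \<phi> = "\<lambda>x. x \<bullet> w"])
        (use t x in \<open>auto intro!: derivative_eq_intros\<close>)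
    show "w \<bullet> w / 2 \<le> X (r x) \<bullet> w"
      using T[of x] t x by simp
  qed (use t in auto)
  with t(1) show False by simp
qed

text \<open>The form attains a positive minimum on \<open>K\<close> times the unit sphere of the
  hyperplane, and homogeneity of degree 2 extends the bound to all \<open>v\<close>. It serves both
  the Hessian and the fractional powers of \<open>J\<close>.\<close>

lemma compact_form_bound:
  fixes B :: "'a::topological_space \<Rightarrow> 'b::euclidean_space \<Rightarrow> 'b"
  assumes "compact K" and cont: "continuous_on (K \<times> UNIV) (\<lambda>(r, v). B r v)"
    and lin: "\<And>r. r \<in> K \<Longrightarrow> linear (B r)"
    and pos: "\<And>r v. r \<in> K \<Longrightarrow> v \<noteq> 0 \<Longrightarrow> u \<bullet> v = 0 \<Longrightarrow> 0 < v \<bullet> B r v"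
  obtains c where "0 < c" "\<And>r v. r \<in> K \<Longrightarrow> u \<bullet> v = 0 \<Longrightarrow> c * (norm v)\<^sup>2 \<le> v \<bullet> B r v"
proof -
  define S where "S = sphere 0 1 \<inter> {v::'b. u \<bullet> v = 0}"
  have "\<exists>c>0. \<forall>(r, v)\<in>K \<times> S. c \<le> v \<bullet> B r v"
  proof (cases "K \<times> S = {}")
    \<comment> \<open>This case does occur: on a graph with a single edge the hyperplane orthogonal
      to \<open>u\<close> is trivial and its unit sphere empty.\<close>
    case True
    then show ?thesis by (auto intro: exI[of _ 1])
  next
    case False
    have "compact S" unfolding S_def
      by (intro compact_Int_closed closed_hyperplane) simp
    then have "compact (K \<times> S)" using \<open>compact K\<close> by (rule compact_Times[rotated])
    moreover have "continuous_on (K \<times> S) (\<lambda>p. snd p \<bullet> (case p of (r, v) \<Rightarrow> B r v))"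
      by (intro continuous_intros continuous_on_subset[OF cont]) auto
    ultimately obtain p where p: "p \<in> K \<times> S"
      "\<forall>q\<in>K \<times> S. snd p \<bullet> (case p of (r, v) \<Rightarrow> B r v) \<le> snd q \<bullet> (case q of (r, v) \<Rightarrow> B r v)"
      using continuous_attains_inf[OF _ False] by blast
    have "0 < snd p \<bullet> (case p of (r, v) \<Rightarrow> B r v)"
      using p(1) by (auto simp: S_def intro!: pos)
    then show ?thesis using p(2) by fastforce
  qed
  then obtain c where c: "0 < c" "\<And>r v. r \<in> K \<Longrightarrow> v \<in> S \<Longrightarrow> c \<le> v \<bullet> B r v" by auto
  have "c * (norm v)\<^sup>2 \<le> v \<bullet> B r v" if "r \<in> K" "u \<bullet> v = 0" for r v
  proof (cases "v = 0")
    case True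
    then show ?thesis by simp
  next
    case False
    define w where "w = v /\<^sub>R norm v"
    have "w \<in> S" using False that by (simp add: S_def w_def)
    then have "c * (norm v)\<^sup>2 \<le> (w \<bullet> B r w) * (norm v)\<^sup>2"
      by (intro mult_right_mono c that) simp_all
    also have "\<dots> = (norm v *\<^sub>R w) \<bullet> B r (norm v *\<^sub>R w)"
      by (simp only: linear_scale[OF lin[OF that(1)]] inner_scaleR_left inner_scaleR_right power2_eq_square)
        simp
    also have "norm v *\<^sub>R w = v" using False by (simp add: w_def)
    finally show ?thesis .
  qed
  with c(1) show thesis by (rule that)
qed

section \<open>Potentials that are convex transversally to one direction\<close>

locale convex_potential =
  fixes \<psi> :: "real^'n::finite \<Rightarrow> real" and g :: "real^'n \<Rightarrow> real^'n"
    and D :: "real^'n \<Rightarrow> real^'n \<Rightarrow> real^'n" and u a :: "real^'n"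
  assumes grad: "(\<psi> has_derivative (\<lambda>v. g r \<bullet> v)) (at r)"
    and hess: "(g has_derivative D r) (at r)"
    and hess_cont: "continuous_on UNIV (\<lambda>(r, v). D r v)"
    and hess_pos: "v \<noteq> 0 \<Longrightarrow> u \<bullet> v = 0 \<Longrightarrow> 0 < v \<bullet> D r v"
    and crit: "g a = 0"
begin

lemma ray_derivs:
  shows "((\<lambda>\<tau>. \<psi> (a + \<tau> *\<^sub>R v)) has_real_derivative g (a + \<tau> *\<^sub>R v) \<bullet> v) (at \<tau> within S)"
    and "((\<lambda>\<tau>. g (a + \<tau> *\<^sub>R v) \<bullet> v) has_real_derivative D (a + \<tau> *\<^sub>R v) v \<bullet> v) (at \<tau> within S)"
proof -
  have ray: "((\<lambda>\<tau>. a + \<tau> *\<^sub>R v) has_derivative (\<lambda>h. h *\<^sub>R v)) (at \<tau> within S)"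
    by (auto intro!: derivative_eq_intros)
  have "((\<lambda>\<tau>. \<psi> (a + \<tau> *\<^sub>R v)) has_derivative (\<lambda>h. g (a + \<tau> *\<^sub>R v) \<bullet> (h *\<^sub>R v))) (at \<tau> within S)"
    by (rule has_derivative_compose[OF ray grad])
  then show "((\<lambda>\<tau>. \<psi> (a + \<tau> *\<^sub>R v)) has_real_derivative g (a + \<tau> *\<^sub>R v) \<bullet> v) (at \<tau> within S)"
    unfolding has_field_derivative_def by (rule has_derivative_eq_rhs) auto
  have "((\<lambda>\<tau>. g (a + \<tau> *\<^sub>R v) \<bullet> v) has_derivative (\<lambda>h. D (a + \<tau> *\<^sub>R v) (h *\<^sub>R v) \<bullet> v)) (at \<tau> within S)"
    by (intro has_derivative_inner_left has_derivative_compose[OF ray hess])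
  then show "((\<lambda>\<tau>. g (a + \<tau> *\<^sub>R v) \<bullet> v) has_real_derivative D (a + \<tau> *\<^sub>R v) v \<bullet> v) (at \<tau> within S)"
    unfolding has_field_derivative_def
    by (rule has_derivative_eq_rhs) (auto simp: linear_scale[OF has_derivative_linear[OF hess]])
qed

lemma ray_mono:
  assumes "u \<bullet> v = 0" "0 \<le> \<tau>" "\<tau> \<le> \<sigma>"
  shows "g (a + \<tau> *\<^sub>R v) \<bullet> v \<le> g (a + \<sigma> *\<^sub>R v) \<bullet> v"
proof -
  have "0 \<le> D r v \<bullet> v" for r
    using hess_pos[of v r] assms(1) by (cases "v = 0") (auto simp: inner_commute)
  then have "0 * (\<sigma> - \<tau>) \<le> g (a + \<sigma> *\<^sub>R v) \<bullet> v - g (a + \<tau> *\<^sub>R v) \<bullet> v"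
    by (intro increment_lower_bound[OF ray_derivs(2)]) (use assms in auto)
  then show ?thesis by simp
qed

text \<open>The two tangent inequalities of a convex function of one variable, on rays that leave
  the critical point \<open>a\<close> orthogonally to \<open>u\<close>; all later convexity
  estimates reduce to these rays.\<close>

lemma ray_convex:
  assumes "u \<bullet> v = 0" "0 \<le> \<tau>" "\<tau> \<le> \<sigma>"
  shows "g (a + \<tau> *\<^sub>R v) \<bullet> v * (\<sigma> - \<tau>) \<le> \<psi> (a + \<sigma> *\<^sub>R v) - \<psi> (a + \<tau> *\<^sub>R v)"
    and "\<psi> (a + \<sigma> *\<^sub>R v) - \<psi> (a + \<tau> *\<^sub>R v) \<le> g (a + \<sigma> *\<^sub>R v) \<bullet> v * (\<sigma> - \<tau>)"
  by (rule increment_lower_bound[OF ray_derivs(1)] increment_upper_bound[OF ray_derivs(1)];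
    use assms in \<open>auto intro: ray_mono\<close>)+

lemma minimum: "u \<bullet> v = 0 \<Longrightarrow> 0 \<le> \<tau> \<Longrightarrow> \<psi> a \<le> \<psi> (a + \<tau> *\<^sub>R v)"
  using ray_convex(1)[of v 0 \<tau>] crit by simp

text \<open>One modulus \<open>c\<close>, the least eigenvalue bound of the Hessian over a ball,
  gives three estimates: growth of the gradient along rays, quadratic growth of the potential, and a
  Polyak-Lojasiewicz inequality bounding the energy excess by the squared gradient.\<close>

lemma strong_convexity:
  obtains c where "0 < c"
    and "\<And>v. u \<bullet> v = 0 \<Longrightarrow> norm v \<le> R \<Longrightarrow> c * (norm v)\<^sup>2 \<le> g (a + v) \<bullet> v"
    and "\<And>v. u \<bullet> v = 0 \<Longrightarrow> norm v \<le> R \<Longrightarrow> c / 4 * (norm v)\<^sup>2 \<le> \<psi> (a + v) - \<psi> a"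
    and "\<And>v. u \<bullet> v = 0 \<Longrightarrow> norm v \<le> R \<Longrightarrow> c * (\<psi> (a + v) - \<psi> a) \<le> (norm (g (a + v)))\<^sup>2"
proof -
  obtain c where c: "0 < c"
    "\<And>r v. r \<in> cball a R \<Longrightarrow> u \<bullet> v = 0 \<Longrightarrow> c * (norm v)\<^sup>2 \<le> v \<bullet> D r v"
  proof (rule compact_form_bound[of "cball a R" D u])
    show "continuous_on (cball a R \<times> UNIV) (\<lambda>(r, v). D r v)"
      by (rule continuous_on_subset[OF hess_cont]) simp
  qed (use hess_pos has_derivative_linear[OF hess] in auto)
  have lower: "c * (norm v)\<^sup>2 \<le> g (a + v) \<bullet> v" if v: "u \<bullet> v = 0" "norm v \<le> R" for v
  proof -
    have "c * (norm v)\<^sup>2 * (1 - 0) \<le> g (a + 1 *\<^sub>R v) \<bullet> v - g (a + 0 *\<^sub>R v) \<bullet> v"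
    proof (rule increment_lower_bound[OF ray_derivs(2)])
      fix \<tau> :: real assume "0 \<le> \<tau>" "\<tau> \<le> 1"
      then have "\<bar>\<tau>\<bar> * norm v \<le> R" using v(2) mult_left_le_one_le[of "norm v" \<tau>] by simp
      then have "a + \<tau> *\<^sub>R v \<in> cball a R" by (simp add: dist_norm)
      then show "c * (norm v)\<^sup>2 \<le> D (a + \<tau> *\<^sub>R v) v \<bullet> v"
        using c(2)[of _ v] v by (simp add: inner_commute)
    qed auto
    then show ?thesis using crit by simp
  qed
  have quad: "c / 4 * (norm v)\<^sup>2 \<le> \<psi> (a + v) - \<psi> a" if v: "u \<bullet> v = 0" "norm v \<le> R" for v
  proof -
    \<comment> \<open>The factor \<open>c / 4\<close> comes from the midpoint: the first half of the
      segment does not lower the energy, and on the second half the slope is at least the one at the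
      midpoint, where the gradient bound applies.\<close>
    have half: "c * (norm ((1/2) *\<^sub>R v))\<^sup>2 \<le> g (a + (1/2) *\<^sub>R v) \<bullet> ((1/2) *\<^sub>R v)"
      using v norm_ge_zero[of v] by (intro lower) (simp_all del: norm_ge_zero)
    have "g (a + (1/2) *\<^sub>R v) \<bullet> v * (1/2) \<le> \<psi> (a + v) - \<psi> (a + (1/2) *\<^sub>R v)"
      using ray_convex(1)[of v "1/2" 1] v by simp
    with half minimum[of v "1/2"] v show ?thesis
      by (simp add: power_mult_distrib power_divide)
  qed
  \<comment> \<open>Convexity bounds the excess by \<open>norm (g (a + v)) * norm v\<close>, and the
    first estimate together with Cauchy-Schwarz gives
    \<open>c * norm v \<le> norm (g (a + v))\<close>.\<close>
  have "c * (\<psi> (a + v) - \<psi> a) \<le> (norm (g (a + v)))\<^sup>2" if v: "u \<bullet> v = 0" "norm v \<le> R" for v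
  proof -
    have up: "\<psi> (a + v) - \<psi> a \<le> g (a + v) \<bullet> v" using ray_convex(2)[of v 0 1] v by simp
    have cs: "g (a + v) \<bullet> v \<le> norm (g (a + v)) * norm v" by (rule norm_cauchy_schwarz)
    have "c * (norm v)\<^sup>2 \<le> norm (g (a + v)) * norm v" using lower[OF v] cs by linarith
    then have "c * norm v \<le> norm (g (a + v))"
      by (cases "v = 0") (simp_all add: power2_eq_square)
    then have "norm (g (a + v)) * (c * norm v) \<le> norm (g (a + v)) * norm (g (a + v))"
      by (intro mult_left_mono) simp_all
    moreover have "c * (\<psi> (a + v) - \<psi> a) \<le> c * (norm (g (a + v)) * norm v)"
      using up cs c(1) by (intro mult_left_mono) auto
    ultimately show ?thesis by (simp add: power2_eq_square algebra_simps)
  qed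
  with c(1) lower quad show thesis by (rule that)
qed

text \<open>On the unit sphere around \<open>a\<close> the radial slope is at least
  \<open>c\<close>, and along a ray the slope never decreases; hence growth outside the unit ball is
  at least linear.\<close>

lemma coercive:
  obtains R where "0 < R" "\<And>v. u \<bullet> v = 0 \<Longrightarrow> \<psi> (a + v) \<le> C \<Longrightarrow> norm v < R"
proof -
  obtain c where c: "0 < c" "\<And>v. u \<bullet> v = 0 \<Longrightarrow> norm v \<le> 1 \<Longrightarrow> c * (norm v)\<^sup>2 \<le> g (a + v) \<bullet> v"
    using strong_convexity[of 1] by metis
  \<comment> \<open>Linear growth gives \<open>norm v \<le> 1 + (C - \<psi> a) / c\<close> outside
    the unit ball; the extra 1 makes the bound strict, and the maximum with 2 covers the unit ball
    and positivity.\<close>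
  define R where "R = max 2 (2 + (C - \<psi> a) / c)"
  have "norm v < R" if v: "u \<bullet> v = 0" "\<psi> (a + v) \<le> C" for v
  proof (cases "norm v \<le> 1")
    case True
    then show ?thesis by (simp add: R_def)
  next
    case False
    define w where "w = v /\<^sub>R norm v"
    have w: "norm w = 1" "u \<bullet> w = 0" "v = norm v *\<^sub>R w"
    proof -
      have "v \<noteq> 0" using False by auto
      then show "norm w = 1" "u \<bullet> w = 0" "v = norm v *\<^sub>R w" using v(1) by (simp_all add: w_def)
    qed
    have "c \<le> g (a + 1 *\<^sub>R w) \<bullet> w" using c(2)[of w] w by simp
    then have "c * (norm v - 1) \<le> g (a + 1 *\<^sub>R w) \<bullet> w * (norm v - 1)"
      using False by (intro mult_right_mono) auto
    also have "\<dots> \<le> \<psi> (a + norm v *\<^sub>R w) - \<psi> (a + 1 *\<^sub>R w)"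
      using ray_convex(1)[of w 1 "norm v"] w False by simp
    also have "\<dots> \<le> C - \<psi> a" using minimum[of w 1] w v by simp
    finally have "norm v - 1 \<le> (C - \<psi> a) / c" using c(1) by (simp add: field_simps)
    then show ?thesis by (simp add: R_def)
  qed
  then show thesis by (intro that[of R]) (auto simp: R_def)
qed

lemma solution_hyperplane:
  assumes tangent: "\<And>r. u \<bullet> X r = 0" and sol: "flow_solution X r0 r" and "0 \<le> t"
  shows "u \<bullet> r t = u \<bullet> r0"
proof -
  have "((\<lambda>t. u \<bullet> r t) has_real_derivative u \<bullet> X (r x)) (at x within {0..})" if "0 \<le> x" for x
    by (rule flow_solution_chain[OF sol that, where \<phi> = "\<lambda>x. u \<bullet> x"])
      (auto intro!: derivative_eq_intros)
  then have "u \<bullet> r t - u \<bullet> r 0 \<le> 0 * (t - 0)" "0 * (t - 0) \<le> u \<bullet> r t - u \<bullet> r 0"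
    using \<open>0 \<le> t\<close>
    by (auto simp: tangent intro: increment_upper_bound[where m = 0 and f' = "\<lambda>_. 0" and s = 0, simplified]
      increment_lower_bound[where m = 0 and f' = "\<lambda>_. 0" and s = 0, simplified])
  then show ?thesis using sol by (simp add: flow_solution_def)
qed

lemma energy_decreasing:
  assumes diss: "\<And>r. g r \<bullet> X r \<le> 0" and sol: "flow_solution X r0 r" and "0 \<le> s" "s \<le> t"
  shows "\<psi> (r t) \<le> \<psi> (r s)"
proof -
  have "\<psi> (r t) - \<psi> (r s) \<le> 0 * (t - s)"
    by (rule increment_upper_bound[OF flow_solution_chain[OF sol _ grad]])
      (use assms in auto)
  then show ?thesis by simp
qed

end

section \<open>Flows that decrease such a potential\<close>

locale dissipative_flow = convex_potential +
  fixes X :: "real^'n::finite \<Rightarrow> real^'n" and r0 :: "real^'n"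
  assumes field_cont: "continuous_on UNIV X"
    and tangent: "u \<bullet> X r = 0"
    and dissipative: "g r \<bullet> X r \<le> 0"
    and start: "u \<bullet> r0 = u \<bullet> a"
begin

text \<open>The quantifier order is the point: \<open>R\<close> depends on \<open>\<psi>\<close> and
  \<open>r0\<close> but not on the field \<open>Y\<close>. A cutoff chosen in terms of
  \<open>R\<close> thus yields a field whose solutions obey the same \<open>R\<close>.\<close>

lemma confined:
  obtains R where "0 < R"
    and "\<And>Y r t. (\<And>r. u \<bullet> Y r = 0) \<Longrightarrow> (\<And>r. g r \<bullet> Y r \<le> 0) \<Longrightarrow> flow_solution Y r0 r \<Longrightarrow> 0 \<le> t \<Longrightarrow>
      u \<bullet> (r t - a) = 0 \<and> norm (r t - a) < R"
proof -
  obtain R where R: "0 < R" "\<And>v. u \<bullet> v = 0 \<Longrightarrow> \<psi> (a + v) \<le> \<psi> r0 \<Longrightarrow> norm v < R"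
    using coercive[of "\<psi> r0"] by metis
  have "u \<bullet> (r t - a) = 0 \<and> norm (r t - a) < R"
    if "\<And>r. u \<bullet> Y r = 0" "\<And>r. g r \<bullet> Y r \<le> 0" "flow_solution Y r0 r" "0 \<le> t" for Y r t
  proof
    show orth: "u \<bullet> (r t - a) = 0"
      using solution_hyperplane[OF that(1,3,4)] start by (simp add: inner_diff_right)
    have "\<psi> (r t) \<le> \<psi> (r 0)" by (rule energy_decreasing[OF that(2,3)]) (use that in auto)
    then show "norm (r t - a) < R"
      using R(2)[of "r t - a"] orth that(3) by (simp add: flow_solution_def)
  qed
  with R(1) show thesis by (rule that)
qed

text \<open>A cutoff makes the field bounded; the energy still decreases along the truncated flow,
  so the solution never leaves the region where the cutoff equals 1.\<close>

lemma solution_exists: "\<exists>r. flow_solution X r0 r"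
proof -
  obtain R where R: "0 < R"
    "\<And>Y r t. (\<And>r. u \<bullet> Y r = 0) \<Longrightarrow> (\<And>r. g r \<bullet> Y r \<le> 0) \<Longrightarrow> flow_solution Y r0 r \<Longrightarrow> 0 \<le> t \<Longrightarrow>
      u \<bullet> (r t - a) = 0 \<and> norm (r t - a) < R"
    using confined by metis
  define cut where "cut = (\<lambda>r. max 0 (min 1 (R + 1 - norm (r - a))))"
  define Y where "Y = (\<lambda>r. cut r *\<^sub>R X r)"
  have contY: "continuous_on UNIV Y"
    unfolding Y_def cut_def by (intro continuous_intros field_cont)
  have "compact (X ` cball a (R + 1))"
    by (intro compact_continuous_image continuous_on_subset[OF field_cont]) auto
  then obtain M where M: "0 < M" "\<And>r. r \<in> cball a (R + 1) \<Longrightarrow> norm (X r) \<le> M"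
    using compact_imp_bounded bounded_pos by (metis imageI)
  have "norm (Y r) \<le> M" for r
  proof (cases "r \<in> cball a (R + 1)")
    case True
    have "\<bar>cut r\<bar> * norm (X r) \<le> 1 * M"
      by (intro mult_mono M True) (auto simp: cut_def)
    then show ?thesis by (simp add: Y_def)
  next
    case False
    then have "cut r = 0" by (auto simp: cut_def dist_norm norm_minus_commute)
    then show ?thesis using M(1) by (simp add: Y_def)
  qed
  then obtain r where r: "r 0 = r0"
    "\<And>t. 0 \<le> t \<Longrightarrow> (r has_vector_derivative Y (r t)) (at t within {0..})"
    using peano_bounded[OF contY] by metis
  then have sol: "flow_solution Y r0 r" by (simp add: flow_solution_def)
  have "cut (r t) = 1" if "0 \<le> t" for t
  proof -
    have "norm (r t - a) < R"
    proof (rule R(2)[of Y, THEN conjunct2])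
      show "u \<bullet> Y r = 0" for r by (simp add: Y_def tangent)
      show "g r \<bullet> Y r \<le> 0" for r
        using dissipative[of r] by (simp add: Y_def cut_def mult_nonneg_nonpos)
    qed (use sol that in auto)
    then show ?thesis by (simp add: cut_def)
  qed
  then have "Y (r t) = X (r t)" if "0 \<le> t" for t using that by (simp add: Y_def)
  then have "flow_solution X r0 r" using r by (simp add: flow_solution_def)
  then show ?thesis by blast
qed

text \<open>Lyapunov argument. Outside a \<open>\<delta>\<close>-ball around \<open>a\<close>, on
  the compact part \<open>K\<close> of the hyperplane, dissipation is at least some
  \<open>m > 0\<close>, so the solution must enter that ball. From then on monotone energy and
  quadratic growth trap it within \<open>\<epsilon>\<close>.\<close>

lemma converges:
  assumes strict: "\<And>r. g r \<noteq> 0 \<Longrightarrow> g r \<bullet> X r < 0"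
  shows "flow_converges X r0 a"
  unfolding flow_converges_def
proof (intro conjI allI impI solution_exists)
  fix r assume sol: "flow_solution X r0 r"
  obtain R where "0 < R" and R: "\<And>t. 0 \<le> t \<Longrightarrow> u \<bullet> (r t - a) = 0 \<and> norm (r t - a) < R"
    using confined tangent dissipative sol by metis
  obtain c where c: "0 < c"
    "\<And>v. u \<bullet> v = 0 \<Longrightarrow> norm v \<le> R \<Longrightarrow> c * (norm v)\<^sup>2 \<le> g (a + v) \<bullet> v"
    "\<And>v. u \<bullet> v = 0 \<Longrightarrow> norm v \<le> R \<Longrightarrow> c / 4 * (norm v)\<^sup>2 \<le> \<psi> (a + v) - \<psi> a"
    using strong_convexity[of R] by metis
  have gcont: "continuous_on UNIV g"
    using hess by (meson continuous_at_imp_continuous_on has_derivative_continuous)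
  have \<psi>cont: "isCont \<psi> a" using grad has_derivative_continuous by blast
  show "(r \<longlongrightarrow> a) at_top"
  proof (rule tendstoI)
    fix \<epsilon> :: real assume "0 < \<epsilon>"
    \<comment> \<open>By quadratic growth, an energy excess below this level forces distance less
      than \<open>\<epsilon>\<close> from \<open>a\<close>.\<close>
    define e where "e = c / 4 * \<epsilon>\<^sup>2"
    have "0 < e" using c(1) \<open>0 < \<epsilon>\<close> by (simp add: e_def)
    then obtain \<delta> where \<delta>: "0 < \<delta>" "\<And>x. dist x a < \<delta> \<Longrightarrow> \<psi> x < \<psi> a + e"
      using \<psi>cont unfolding continuous_at_eps_delta dist_real_def by (smt (verit, best))
    define K where "K = cball a R \<inter> {x. u \<bullet> x = u \<bullet> a} \<inter> {x. \<delta> \<le> dist x a}"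
    have "compact K" unfolding K_def
      by (intro compact_Int_closed closed_hyperplane closed_Collect_le continuous_intros) simp
    have "\<exists>m>0. \<forall>x\<in>K. g x \<bullet> X x \<le> - m"
    proof (cases "K = {}")
      case True
      then show ?thesis by (auto intro: exI[of _ 1])
    next
      case False
      have "continuous_on K (\<lambda>x. g x \<bullet> X x)"
        by (intro continuous_intros continuous_on_subset[OF gcont] continuous_on_subset[OF field_cont]) auto
      then obtain x where x: "x \<in> K" "\<forall>y\<in>K. g y \<bullet> X y \<le> g x \<bullet> X x"
        using continuous_attains_sup[OF \<open>compact K\<close> False] by blast
      have "c * (norm (x - a))\<^sup>2 \<le> g (a + (x - a)) \<bullet> (x - a)"
        using x(1) by (intro c(2)) (auto simp: K_def dist_norm norm_minus_commute inner_diff_right)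
      moreover have "0 < c * (norm (x - a))\<^sup>2"
      proof -
        have "x \<noteq> a" using x(1) \<delta>(1) by (auto simp: K_def)
        then show ?thesis using c(1) by simp
      qed
      ultimately have "g x \<noteq> 0" by auto
      then have "g x \<bullet> X x < 0" by (rule strict)
      then show ?thesis using x(2) by (intro exI[of _ "- (g x \<bullet> X x)"]) auto
    qed
    then obtain m where m: "0 < m" "\<And>x. x \<in> K \<Longrightarrow> g x \<bullet> X x \<le> - m" by auto
    have "\<exists>T\<ge>0. dist (r T) a < \<delta>"
    proof (rule ccontr)
      assume "\<not> ?thesis"
      then have inK: "r t \<in> K" if "0 \<le> t" for t
        using R[OF that] that
        by (force simp: K_def dist_norm norm_minus_commute inner_diff_right)
      \<comment> \<open>Time after which losing energy at rate \<open>m\<close> would have brought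
        it to \<open>\<psi> a - 1\<close>, below the minimum.\<close>
      define t where "t = (\<psi> r0 - \<psi> a + 1) / m"
      have "\<psi> a \<le> \<psi> r0"
        using minimum[of "r0 - a" 1] start by (simp add: inner_diff_right)
      then have "0 \<le> t" using m(1) by (simp add: t_def)
      have "\<psi> (r t) - \<psi> (r 0) \<le> - m * (t - 0)"
        by (rule increment_upper_bound[OF flow_solution_chain[OF sol _ grad]])
          (use \<open>0 \<le> t\<close> m inK in auto)
      also have "\<dots> = \<psi> a - \<psi> r0 - 1" using m(1) by (simp add: t_def)
      finally have "\<psi> (r t) < \<psi> a" using sol by (simp add: flow_solution_def)
      then show False
        using minimum[of "r t - a" 1] R[OF \<open>0 \<le> t\<close>] by simp
    qed
    then obtain T where T: "0 \<le> T" "dist (r T) a < \<delta>" by blast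
    have "dist (r t) a < \<epsilon>" if "T \<le> t" for t
    proof -
      have "0 \<le> t" using T that by simp
      have "c / 4 * (norm (r t - a))\<^sup>2 \<le> \<psi> (r t) - \<psi> a"
        using c(3)[of "r t - a"] R[OF \<open>0 \<le> t\<close>] by simp
      also have "\<dots> \<le> \<psi> (r T) - \<psi> a"
        using energy_decreasing[OF dissipative sol T(1) that] by simp
      also have "\<dots> < c / 4 * \<epsilon>\<^sup>2" using \<delta>(2)[OF T(2)] by (simp add: e_def)
      finally have "(norm (r t - a))\<^sup>2 < \<epsilon>\<^sup>2" using c(1) by simp
      then show ?thesis using \<open>0 < \<epsilon>\<close> by (simp add: dist_norm power2_less_imp_less)
    qed
    then show "eventually (\<lambda>t. dist (r t) a < \<epsilon>) at_top"
      unfolding eventually_at_top_linorder by blast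
  qed
qed

text \<open>Dissipation controls the squared gradient, which by the Polyak-Lojasiewicz inequality
  controls the excess \<open>P\<close>; hence \<open>P' \<le> - \<mu> P\<close>. Quadratic growth
  then makes the distance decay at half that rate. \<open>rate\<close> is assumed for every ball
  because the confinement radius only appears in the proof.\<close>

lemma converges_exponentially:
  assumes rate: "\<And>R. \<exists>b>0. \<forall>r\<in>cball a R. g r \<bullet> X r \<le> - b * (norm (g r))\<^sup>2"
  shows "flow_converges_exp X r0 a"
  unfolding flow_converges_exp_def
proof (intro conjI allI impI solution_exists)
  fix r assume sol: "flow_solution X r0 r"
  obtain R where "0 < R" and R: "\<And>t. 0 \<le> t \<Longrightarrow> u \<bullet> (r t - a) = 0 \<and> norm (r t - a) < R"
    using confined tangent dissipative sol by metis
  obtain c where c: "0 < c"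
    "\<And>v. u \<bullet> v = 0 \<Longrightarrow> norm v \<le> R \<Longrightarrow> c / 4 * (norm v)\<^sup>2 \<le> \<psi> (a + v) - \<psi> a"
    "\<And>v. u \<bullet> v = 0 \<Longrightarrow> norm v \<le> R \<Longrightarrow> c * (\<psi> (a + v) - \<psi> a) \<le> (norm (g (a + v)))\<^sup>2"
    using strong_convexity[of R] by metis
  obtain b where b: "0 < b" "\<And>r. r \<in> cball a R \<Longrightarrow> g r \<bullet> X r \<le> - b * (norm (g r))\<^sup>2"
    using rate[of R] by blast
  define P where "P = (\<lambda>t. \<psi> (r t) - \<psi> a)"
  define \<mu> where "\<mu> = b * c"
  have "0 < \<mu>" using b(1) c(1) by (simp add: \<mu>_def)
  have P': "(P has_real_derivative g (r t) \<bullet> X (r t)) (at t within {0..})" if "0 \<le> t" for t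
    unfolding P_def using flow_solution_chain[OF sol that grad]
    by (auto intro!: derivative_eq_intros)
  have decay: "g (r t) \<bullet> X (r t) \<le> - \<mu> * P t" if "0 \<le> t" for t
  proof -
    have "g (r t) \<bullet> X (r t) \<le> - b * (norm (g (r t)))\<^sup>2"
      using R[OF that] by (intro b(2)) (simp add: dist_norm norm_minus_commute)
    moreover have "b * (c * P t) \<le> b * (norm (g (r t)))\<^sup>2"
      using c(3)[of "r t - a"] R[OF that] b(1) by (intro mult_left_mono) (simp_all add: P_def)
    ultimately show ?thesis by (simp add: \<mu>_def)
  qed
  have Pexp: "P t \<le> P 0 * exp (- \<mu> * t)" if "0 \<le> t" for t
  proof -
    \<comment> \<open>Gronwall by integrating factor: \<open>P t * exp (\<mu> * t)\<close> is
      nonincreasing.\<close>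
    have "P t * exp (\<mu> * t) - P 0 * exp (\<mu> * 0) \<le> 0 * (t - 0)"
    proof (rule increment_upper_bound)
      fix x :: real assume x: "0 \<le> x" "x \<le> t"
      show "((\<lambda>t. P t * exp (\<mu> * t)) has_real_derivative
          (g (r x) \<bullet> X (r x) + \<mu> * P x) * exp (\<mu> * x)) (at x within {0..})"
        using P'[OF x(1)] by (auto intro!: derivative_eq_intros simp: algebra_simps)
      show "(g (r x) \<bullet> X (r x) + \<mu> * P x) * exp (\<mu> * x) \<le> 0"
        using decay[OF x(1)] by (intro mult_nonpos_nonneg) auto
    qed (use that in auto)
    then show ?thesis by (simp add: exp_minus field_simps)
  qed
  \<comment> \<open>The summand 1 keeps \<open>C\<close> positive when the flow starts at
    \<open>a\<close>, where \<open>P 0 = 0\<close>.\<close>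
  define C where "C = sqrt (4 * P 0 / c) + 1"
  have P0: "0 \<le> P 0" using minimum[of "r 0 - a" 1] R[of 0] by (simp add: P_def)
  have "norm (r t - a) \<le> C * exp (- (\<mu> / 2) * t)" if "0 \<le> t" for t
  proof -
    have "c / 4 * (norm (r t - a))\<^sup>2 \<le> P t"
      using c(2)[of "r t - a"] R[OF that] by (simp add: P_def)
    also have "\<dots> \<le> P 0 * exp (- \<mu> * t)" by (rule Pexp[OF that])
    finally have "(norm (r t - a))\<^sup>2 \<le> 4 * P 0 / c * exp (- \<mu> * t)"
      using c(1) by (simp add: field_simps)
    also have "\<dots> = (sqrt (4 * P 0 / c) * exp (- (\<mu> / 2) * t))\<^sup>2"
      using P0 c(1) by (simp add: power_mult_distrib exp_double[symmetric])
    finally have "norm (r t - a) \<le> sqrt (4 * P 0 / c) * exp (- (\<mu> / 2) * t)"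
      by (rule power2_le_imp_le) (use P0 c(1) in simp)
    also have "\<dots> \<le> C * exp (- (\<mu> / 2) * t)"
      by (intro mult_right_mono) (simp_all add: C_def)
    finally show ?thesis .
  qed
  moreover have "0 < C" using P0 c(1) by (simp add: C_def add_nonneg_pos)
  moreover have "0 < \<mu> / 2" using \<open>0 < \<mu>\<close> by simp
  ultimately show "\<exists>C>0. \<exists>l>0. \<forall>t\<ge>0. norm (r t - a) \<le> C * exp (- l * t)" by blast
qed

end

lemma flow_converges_exp_imp_flow_converges:
  assumes "flow_converges_exp X r0 a"
  shows "flow_converges X r0 a"
  unfolding flow_converges_def
proof (intro conjI allI impI)
  show "\<exists>r. flow_solution X r0 r" using assms by (simp add: flow_converges_exp_def)
  fix r assume "flow_solution X r0 r"
  then obtain C l where Cl: "0 < l" "\<And>t. 0 \<le> t \<Longrightarrow> norm (r t - a) \<le> C * exp (- l * t)"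
    using assms unfolding flow_converges_exp_def by metis
  have "filterlim (\<lambda>t. - l * t) at_bot at_top"
    using Cl(1) by (intro filterlim_tendsto_neg_mult_at_bot[OF tendsto_const _ filterlim_ident]) simp
  then have "((\<lambda>t. exp (- l * t)) \<longlongrightarrow> 0) at_top"
    by (rule filterlim_compose[OF exp_at_bot])
  then have "((\<lambda>t. C * exp (- l * t)) \<longlongrightarrow> 0) at_top"
    by (rule tendsto_mult_right_zero)
  moreover have "eventually (\<lambda>t. norm (r t - a) \<le> C * exp (- l * t)) at_top"
    by (rule eventually_at_top_linorderI[of 0]) (rule Cl(2))
  ultimately have "((\<lambda>t. r t - a) \<longlongrightarrow> 0) at_top"
    by (rule Lim_null_comparison[rotated])
  then show "(r \<longlongrightarrow> a) at_top" by (simp add: LIM_zero_iff)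
qed

lemma flow_converges_stationary:
  assumes "flow_converges X r0 a" "isCont X a"
  shows "X a = 0"
  using assms flow_limit_stationary unfolding flow_converges_def by blast

section \<open>Powers of symmetric matrices\<close>

declare transpose_matrix_vector [simp del]

text \<open>A maximizer \<open>v\<close> of the Rayleigh quotient on the unit sphere of
  \<open>S\<close> is an eigenvector: invariance puts the residual
  \<open>w = f v - c *\<^sub>R v\<close> in \<open>S\<close>, and a nonzero \<open>w\<close> would
  be a direction of first-order increase.\<close>

lemma symmetric_eigenvector:
  fixes f :: "'a::euclidean_space \<Rightarrow> 'a"
  assumes lin: "linear f" and sym: "\<And>x y. f x \<bullet> y = x \<bullet> f y"
    and S: "subspace S" "\<And>x. x \<in> S \<Longrightarrow> f x \<in> S" "S \<noteq> {0}"
  obtains v c where "v \<in> S" "norm v = 1" "f v = c *\<^sub>R v"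
proof -
  let ?K = "sphere 0 1 \<inter> S"
  have "compact ?K" by (intro compact_Int_closed closed_subspace S) simp
  moreover have "?K \<noteq> {}"
  proof -
    obtain x where x: "x \<in> S" "x \<noteq> 0" using S(1,3) subspace_0 by blast
    then have "x /\<^sub>R norm x \<in> ?K" using S(1) by (simp add: subspace_scale)
    then show ?thesis by blast
  qed
  moreover have "continuous_on ?K (\<lambda>v. v \<bullet> f v)"
    by (intro continuous_intros linear_continuous_on linear_conv_bounded_linear[THEN iffD1] lin)
  ultimately obtain v where "v \<in> ?K" and "\<forall>w\<in>?K. w \<bullet> f w \<le> v \<bullet> f v"
    using continuous_attains_sup[of ?K "\<lambda>v. v \<bullet> f v"] by blast
  then have v: "norm v = 1" "v \<in> S"
    and max: "\<And>w. norm w = 1 \<Longrightarrow> w \<in> S \<Longrightarrow> w \<bullet> f w \<le> v \<bullet> f v"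
    by auto
  define c where "c = v \<bullet> f v"
  have bound: "w \<bullet> f w \<le> c * (w \<bullet> w)" if "w \<in> S" for w
  proof (cases "w = 0")
    case True
    then show ?thesis by simp
  next
    case False
    define z where "z = w /\<^sub>R norm w"
    have w: "w = norm w *\<^sub>R z" using False by (simp add: z_def)
    have "z \<bullet> f z \<le> c"
      unfolding c_def using False that S(1) by (intro max) (auto simp: z_def subspace_scale)
    then have "(norm w)\<^sup>2 * (z \<bullet> f z) \<le> (norm w)\<^sup>2 * c" by (intro mult_left_mono) simp_all
    moreover have "w \<bullet> f w = (norm w)\<^sup>2 * (z \<bullet> f z)"
      by (subst (1 2) w) (simp only: linear_scale[OF lin] inner_scaleR_left inner_scaleR_right,
        simp add: power2_eq_square)
    ultimately show ?thesis by (simp add: power2_norm_eq_inner mult.commute)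
  qed
  define w where "w = f v - c *\<^sub>R v"
  have wS: "w \<in> S" unfolding w_def by (intro subspace_diff subspace_scale S v)
  have vw: "v \<bullet> w = 0" using v(1) by (simp add: w_def inner_diff_right c_def norm_eq_1)
  have fvw: "f v \<bullet> w = w \<bullet> w" using vw by (simp add: w_def inner_diff_left inner_commute)
  \<comment> \<open>The maximality bound at \<open>v + \<tau> *\<^sub>R w\<close>: by symmetry the
    first-order gain is \<open>2 * \<tau> * (w \<bullet> w)\<close>, set against a quadratic
    remainder.\<close>
  have quad: "2 * \<tau> * (w \<bullet> w) \<le> \<tau>\<^sup>2 * (c * (w \<bullet> w) - w \<bullet> f w)" for \<tau>
  proof -
    have "(v + \<tau> *\<^sub>R w) \<bullet> f (v + \<tau> *\<^sub>R w) \<le> c * ((v + \<tau> *\<^sub>R w) \<bullet> (v + \<tau> *\<^sub>R w))"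
      by (intro bound subspace_add subspace_scale S v wS)
    moreover have "f (v + \<tau> *\<^sub>R w) = f v + \<tau> *\<^sub>R f w"
      by (simp add: linear_add[OF lin] linear_scale[OF lin])
    moreover have "v \<bullet> f w = w \<bullet> w" using sym[of v w] fvw by simp
    moreover have "w \<bullet> f v = w \<bullet> w" using fvw by (simp add: inner_commute)
    moreover have "w \<bullet> v = 0" using vw by (simp add: inner_commute)
    ultimately show ?thesis
      using vw v(1) by (simp add: inner_add_left inner_add_right norm_eq_1 c_def[symmetric]
        algebra_simps power2_eq_square)
  qed
  have "w \<bullet> w = 0"
  proof (rule ccontr)
    assume "w \<bullet> w \<noteq> 0"
    then have pos: "0 < w \<bullet> w" by simp
    define k where "k = c * (w \<bullet> w) - w \<bullet> f w"
    \<comment> \<open>Small enough that the remainder coefficient satisfies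
      \<open>\<tau> * k \<le> w \<bullet> w\<close>; the summand 1 covers
      \<open>k = 0\<close>.\<close>
    define \<tau> where "\<tau> = (w \<bullet> w) / (\<bar>k\<bar> + 1)"
    have "0 < \<tau>" using pos by (simp add: \<tau>_def)
    have "\<tau> * (2 * (w \<bullet> w)) \<le> \<tau> * (\<tau> * k)"
      using quad[of \<tau>] by (simp add: k_def power2_eq_square algebra_simps)
    then have "2 * (w \<bullet> w) \<le> \<tau> * k" using \<open>0 < \<tau>\<close> by simp
    also have "\<dots> \<le> \<tau> * (\<bar>k\<bar> + 1)" using \<open>0 < \<tau>\<close> by simp
    also have "\<dots> = w \<bullet> w" by (simp add: \<tau>_def)
    finally show False using pos by simp
  qed
  then have "f v = c *\<^sub>R v" by (simp add: w_def)
  with v show thesis by (intro that)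
qed

text \<open>Take an orthonormal set of eigenvectors of greatest cardinality. By symmetry its
  orthogonal complement is invariant, so if nonzero it would contain a further eigenvector.\<close>

lemma symmetric_eigenbasis:
  fixes f :: "'a::euclidean_space \<Rightarrow> 'a"
  assumes lin: "linear f" and sym: "\<And>x y. f x \<bullet> y = x \<bullet> f y"
  obtains B where "pairwise orthogonal B" "card B = DIM('a)"
    "\<And>b. b \<in> B \<Longrightarrow> norm b = 1" "\<And>b. b \<in> B \<Longrightarrow> \<exists>c. f b = c *\<^sub>R b"
proof -
  define P where "P = (\<lambda>B. pairwise orthogonal B \<and> (\<forall>b\<in>B. norm b = 1 \<and> (\<exists>c. f b = c *\<^sub>R b)))"
  have ind: "independent B" if "P B" for B
    using that by (intro pairwise_orthogonal_independent) (force simp: P_def)+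
  have fin: "finite B" "card B \<le> DIM('a)" if "P B" for B
    using ind[OF that] independent_bound by auto
  have "P {}" by (simp add: P_def pairwise_def)
  then obtain B where B: "P B" "\<And>B'. P B' \<Longrightarrow> card B' \<le> card B"
    using ex_has_greatest_nat[of P "{}" card "Suc DIM('a)"] fin(2) by (metis le_imp_less_Suc)
  define S where "S = {x. \<forall>b\<in>B. orthogonal x b}"
  have sub: "subspace S"
    by (auto simp: S_def subspace_def orthogonal_clauses)
  have inv: "f x \<in> S" if "x \<in> S" for x
  proof -
    have "orthogonal (f x) b" if "b \<in> B" for b
    proof -
      obtain c where "f b = c *\<^sub>R b" using B(1) \<open>b \<in> B\<close> by (auto simp: P_def)
      then show ?thesis using \<open>x \<in> S\<close> \<open>b \<in> B\<close> sym[of x b] by (simp add: S_def orthogonal_def)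
    qed
    then show ?thesis by (simp add: S_def)
  qed
  have "S = {0}"
  proof (rule ccontr)
    assume "S \<noteq> {0}"
    then obtain v c where v: "v \<in> S" "norm v = 1" "f v = c *\<^sub>R v"
      using symmetric_eigenvector[OF lin sym sub inv] by metis
    have "v \<notin> B"
      using v(1,2) by (auto simp: S_def orthogonal_self)
    have "P (insert v B)"
      using B(1) v by (auto simp: P_def pairwise_insert S_def orthogonal_commute)
    from B(2)[OF this] show False using \<open>v \<notin> B\<close> fin(1)[OF B(1)] by simp
  qed
  have "span B = UNIV"
  proof (rule ccontr)
    assume "span B \<noteq> UNIV"
    then obtain x where "x \<noteq> 0" "\<And>b. b \<in> span B \<Longrightarrow> x \<bullet> b = 0"
      using span_not_UNIV_orthogonal by metis
    then have "x \<in> S" by (auto simp: S_def orthogonal_def span_base)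
    with \<open>S = {0}\<close> \<open>x \<noteq> 0\<close> show False by simp
  qed
  then have "card B = DIM('a)"
    using ind[OF B(1)] by (metis dim_UNIV dim_eq_card_independent dim_span)
  with B(1) show thesis by (intro that[of B]) (auto simp: P_def)
qed

lemma symmetric_matrix_dot:
  fixes A :: "real^'n^'n"
  assumes "transpose A = A"
  shows "(A *v x) \<bullet> y = x \<bullet> (A *v y)"
  by (metis assms dot_lmul_matrix transpose_matrix_vector)

lemma diag_matrix_mult_vec: "diag_matrix d *v x = (\<chi> i. d $ i * x $ i)"
proof -
  have "(\<Sum>j\<in>UNIV. (if i = j then d $ i else 0) * x $ j) = d $ i * x $ i" for i
  proof -
    have "(\<Sum>j\<in>UNIV. (if i = j then d $ i else 0) * x $ j)
        = (\<Sum>j\<in>UNIV. if i = j then d $ i * x $ j else 0)"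
      by (intro sum.cong) auto
    then show ?thesis by simp
  qed
  then show ?thesis by (simp add: diag_matrix_def matrix_vector_mult_def)
qed

lemma transpose_diag_matrix [simp]: "transpose (diag_matrix d) = diag_matrix d"
  by (auto simp: transpose_def diag_matrix_def vec_eq_iff)

lemma symmetric_diagonalization:
  fixes A :: "real^'n^'n"
  assumes "transpose A = A"
  obtains Q d where "orthogonal_matrix Q" "A = transpose Q ** diag_matrix d ** Q"
proof -
  obtain B where B: "pairwise orthogonal B" "card B = CARD('n)"
    "\<And>b. b \<in> B \<Longrightarrow> norm b = 1" "\<And>b. b \<in> B \<Longrightarrow> \<exists>c. A *v b = c *\<^sub>R b"
    using symmetric_eigenbasis[of "(*v) A", OF matrix_vector_mul_linear symmetric_matrix_dot[OF assms],
      unfolded DIM_cart DIM_real mult_1_right] by metis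
  have "finite B" using B(2) by (metis card_gt_0_iff zero_less_card_finite)
  then obtain f where f: "bij_betw f (UNIV :: 'n set) B"
    using finite_same_card_bij[of "UNIV :: 'n set" B] B(2) by auto
  have fB: "f i \<in> B" for i using f by (auto simp: bij_betw_def)
  have "\<forall>i. \<exists>c. A *v f i = c *\<^sub>R f i" using B(4)[OF fB] by blast
  from choice[OF this] obtain c where c: "\<And>i. A *v f i = c i *\<^sub>R f i" by blast
  \<comment> \<open>Eigenvectors form the rows, not the columns, to match the convention
    \<open>A = transpose Q ** diag_matrix d ** Q\<close>.\<close>
  define Q where "Q = (\<chi> i. f i)"
  have row: "row i Q = f i" for i by (simp add: Q_def row_def)
  have Q: "orthogonal_matrix Q"
    unfolding orthogonal_matrix_orthonormal_rows row
  proof (intro conjI allI impI)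
    show "norm (f i) = 1" for i using B(3)[OF fB] .
    show "orthogonal (f i) (f j)" if "i \<noteq> j" for i j
    proof -
      have "f i \<noteq> f j" using bij_betw_imp_inj_on[OF f] that by (blast dest: injD)
      then show ?thesis using B(1) fB by (simp add: pairwise_def)
    qed
  qed
  have "diag_matrix (\<chi> i. c i) ** Q = Q ** A"
  proof -
    have "(diag_matrix (\<chi> i. c i) ** Q) *v x = (Q ** A) *v x" for x
    proof -
      have "f i \<bullet> (A *v x) = c i * (f i \<bullet> x)" for i
        using symmetric_matrix_dot[OF assms, of "f i" x] c[of i] by simp
      moreover have "(Q *v y) $ i = f i \<bullet> y" for y i
        by (simp add: matrix_vector_mul_component Q_def)
      ultimately show ?thesis
        by (simp add: matrix_vector_mul_assoc[symmetric] diag_matrix_mult_vec vec_eq_iff)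
    qed
    then show ?thesis by (simp add: matrix_eq)
  qed
  then have "transpose Q ** diag_matrix (\<chi> i. c i) ** Q = transpose Q ** Q ** A"
    by (simp add: matrix_mul_assoc[symmetric])
  also have "\<dots> = A" using Q by (simp add: orthogonal_matrix)
  finally show thesis using Q by (intro that) auto
qed

lemma diagonalized_mult_vec:
  fixes Q :: "real^'n^'n"
  shows "(transpose Q ** diag_matrix d ** Q) *v v = transpose Q *v (\<chi> i. d $ i * (Q *v v) $ i)"
  by (simp add: matrix_vector_mul_assoc[symmetric] diag_matrix_mult_vec)

text \<open>The coordinates \<open>Q *v v\<close> of an eigenvector are supported where
  \<open>d $ i = c\<close>, so any \<open>f\<close> applied to the diagonal acts on \<open>v\<close>
  as \<open>f c\<close>. The right-hand side no longer mentions \<open>Q\<close> or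
  \<open>d\<close>, which is why functions of a matrix are well defined.\<close>

lemma diagonalized_eigenvector:
  fixes Q :: "real^'n^'n"
  assumes Q: "orthogonal_matrix Q" and v: "(transpose Q ** diag_matrix d ** Q) *v v = c *\<^sub>R v"
  shows "(transpose Q ** diag_matrix (\<chi> i. f (d $ i)) ** Q) *v v = f c *\<^sub>R v"
proof -
  have cancel: "Q *v (transpose Q *v x) = x" "transpose Q *v (Q *v x) = x" for x
    using Q by (simp_all add: matrix_vector_mul_assoc orthogonal_matrix_def)
  have "(\<chi> i. d $ i * (Q *v v) $ i) = Q *v (c *\<^sub>R v)"
    using v cancel(1) unfolding diagonalized_mult_vec by metis
  then have "d $ i * (Q *v v) $ i = c * (Q *v v) $ i" for i
    by (simp add: vec_eq_iff matrix_vector_mult_scaleR)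
  then have "f (d $ i) * (Q *v v) $ i = f c * (Q *v v) $ i" for i
    by (cases "(Q *v v) $ i = 0") auto
  then have "(\<chi> i. f (d $ i) * (Q *v v) $ i) = f c *\<^sub>R (Q *v v)"
    by (simp add: vec_eq_iff)
  then show ?thesis
    by (simp add: diagonalized_mult_vec matrix_vector_mult_scaleR cancel)
qed

text \<open>Eigenvectors of a symmetric matrix span the space, here as the columns of
  \<open>transpose Q\<close>. Identities between functions of \<open>A\<close> can thus be checked
  one eigenvector at a time.\<close>

lemma matrix_eqI_eigenvectors:
  fixes A B C :: "real^'n^'n"
  assumes sym: "transpose A = A"
    and eq: "\<And>v c. A *v v = c *\<^sub>R v \<Longrightarrow> B *v v = C *v v"
  shows "B = C"
proof -
  obtain Q d where Q: "orthogonal_matrix Q" and A: "A = transpose Q ** diag_matrix d ** Q"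
    using symmetric_diagonalization[OF sym] by metis
  have "B *v (transpose Q *v x) = C *v (transpose Q *v x)" for x
  proof -
    have "A *v (transpose Q *v axis i 1) = d $ i *\<^sub>R (transpose Q *v axis i 1)" for i
    proof -
      have "Q *v (transpose Q *v axis i 1) = axis i 1"
        using Q by (simp add: matrix_vector_mul_assoc orthogonal_matrix_def)
      moreover have "(\<chi> j. d $ j * axis i 1 $ j) = d $ i *\<^sub>R axis i (1::real)"
        by (simp add: vec_eq_iff axis_def)
      ultimately show ?thesis
        unfolding A diagonalized_mult_vec by (simp add: matrix_vector_mult_scaleR)
    qed
    from eq[OF this] have "(B ** transpose Q) *v axis i 1 = (C ** transpose Q) *v axis i 1" for i
      by (simp add: matrix_vector_mul_assoc)
    then have "B ** transpose Q = C ** transpose Q"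
      by (simp add: matrix_vector_mult_basis column_def vec_eq_iff)
    then show ?thesis by (simp add: matrix_vector_mul_assoc)
  qed
  moreover have "transpose Q *v (Q *v x) = x" for x
    using Q by (simp add: matrix_vector_mul_assoc orthogonal_matrix_def)
  ultimately show ?thesis unfolding matrix_eq by metis
qed

text \<open>Resolves the definite description: two diagonalizations give matrices that agree on
  every eigenvector of \<open>A\<close>.\<close>

lemma matrix_powr_diagonalized:
  fixes Q :: "real^'n^'n"
  assumes Q: "orthogonal_matrix Q" and A: "A = transpose Q ** diag_matrix d ** Q"
  shows "matrix_powr A s = transpose Q ** diag_matrix (\<chi> i. (d $ i) powr s) ** Q"
  unfolding matrix_powr_def
proof (rule the_equality)
  fix B assume "\<exists>Q d. orthogonal_matrix Q \<and> A = transpose Q ** diag_matrix d ** Q \<and>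
     B = transpose Q ** diag_matrix (\<chi> i. (d $ i) powr s) ** Q"
  then obtain Q' d' where Q': "orthogonal_matrix Q'" and A': "A = transpose Q' ** diag_matrix d' ** Q'"
    and B: "B = transpose Q' ** diag_matrix (\<chi> i. (d' $ i) powr s) ** Q'" by blast
  show "B = transpose Q ** diag_matrix (\<chi> i. (d $ i) powr s) ** Q"
  proof (rule matrix_eqI_eigenvectors)
    show "transpose A = A"
      unfolding A by (simp add: matrix_transpose_mul matrix_mul_assoc)
    fix v c assume "A *v v = c *\<^sub>R v"
    then show "B *v v = (transpose Q ** diag_matrix (\<chi> i. (d $ i) powr s) ** Q) *v v"
      using diagonalized_eigenvector[OF Q', of d' v c "\<lambda>x. x powr s"]
        diagonalized_eigenvector[OF Q, of d v c "\<lambda>x. x powr s"] A A' B by simp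
  qed
qed (use assms in blast)

lemma matrix_powr_eigenvector:
  fixes A :: "real^'n^'n"
  assumes "transpose A = A" "A *v v = c *\<^sub>R v"
  shows "matrix_powr A s *v v = (c powr s) *\<^sub>R v"
proof -
  obtain Q d where "orthogonal_matrix Q" "A = transpose Q ** diag_matrix d ** Q"
    using symmetric_diagonalization[OF assms(1)] by metis
  then show ?thesis
    using matrix_powr_diagonalized[of Q A d s] diagonalized_eigenvector[of Q d v c "\<lambda>x. x powr s"]
      assms(2) by simp
qed

lemma transpose_matrix_powr:
  fixes A :: "real^'n^'n"
  assumes "transpose A = A"
  shows "transpose (matrix_powr A s) = matrix_powr A s"
proof -
  obtain Q d where "orthogonal_matrix Q" "A = transpose Q ** diag_matrix d ** Q"
    using symmetric_diagonalization[OF assms] by metis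
  then show ?thesis
    using matrix_powr_diagonalized[of Q A d s] by (simp add: matrix_transpose_mul matrix_mul_assoc)
qed

text \<open>Semidefiniteness enters because \<open>c powr 1 = c\<close> requires
  \<open>0 \<le> c\<close>.\<close>

lemma matrix_powr_one:
  fixes A :: "real^'n^'n"
  assumes sym: "transpose A = A" and psd: "\<And>v. 0 \<le> v \<bullet> (A *v v)"
  shows "matrix_powr A 1 = A"
proof (rule matrix_eqI_eigenvectors[OF sym])
  fix v c assume v: "A *v v = c *\<^sub>R v"
  have "c *\<^sub>R v = (c powr 1) *\<^sub>R v"
  proof (cases "v = 0")
    case False
    then have "0 < v \<bullet> v" by simp
    moreover have "0 \<le> c * (v \<bullet> v)" using psd[of v] v by simp
    ultimately have "0 \<le> c" by (metis mult_neg_pos not_le)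
    then show ?thesis by simp
  qed simp
  then show "matrix_powr A 1 *v v = A *v v"
    using matrix_powr_eigenvector[OF sym v, of 1] v by metis
qed

text \<open>In eigencoordinates the form is a sum of squares with weights
  \<open>(d $ i) powr s\<close>, which are nonnegative and vanish only where
  \<open>d $ i = 0\<close>. So for every \<open>s\<close>, null vectors of the form lie in the
  kernel of \<open>A\<close>.\<close>

lemma matrix_powr_nonneg:
  fixes A :: "real^'n^'n"
  assumes "transpose A = A"
  shows "0 \<le> v \<bullet> (matrix_powr A s *v v)"
    and "v \<bullet> (matrix_powr A s *v v) = 0 \<Longrightarrow> A *v v = 0"
proof -
  obtain Q d where Q: "orthogonal_matrix Q" and A: "A = transpose Q ** diag_matrix d ** Q"
    using symmetric_diagonalization[OF assms] by metis
  have "v \<bullet> (matrix_powr A s *v v) = (Q *v v) \<bullet> (\<chi> i. (d $ i) powr s * (Q *v v) $ i)"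
    unfolding matrix_powr_diagonalized[OF Q A] diagonalized_mult_vec
    by (simp add: dot_lmul_matrix[symmetric] del: transpose_matrix_vector)
  also have "\<dots> = (\<Sum>i\<in>UNIV. (d $ i) powr s * ((Q *v v) $ i)\<^sup>2)"
    by (simp add: inner_vec_def power2_eq_square mult_ac)
  finally have *: "v \<bullet> (matrix_powr A s *v v) = (\<Sum>i\<in>UNIV. (d $ i) powr s * ((Q *v v) $ i)\<^sup>2)" .
  then show "0 \<le> v \<bullet> (matrix_powr A s *v v)" by (simp add: sum_nonneg)
  assume "v \<bullet> (matrix_powr A s *v v) = 0"
  then have "\<forall>i\<in>UNIV. (d $ i) powr s * ((Q *v v) $ i)\<^sup>2 = 0"
    unfolding * by (subst (asm) sum_nonneg_eq_0_iff) auto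
  then have "(\<chi> i. d $ i * (Q *v v) $ i) = 0" by (auto simp: vec_eq_iff)
  then show "A *v v = 0" unfolding A diagonalized_mult_vec by simp
qed

text \<open>\<open>f\<close> is computed from a witness \<open>q\<close> that need not depend
  continuously on \<open>x\<close>, as happens with diagonalizing matrices where eigenvalues cross.
  Preimages of closed sets are projections of closed sets along a compact factor, hence
  closed.\<close>

lemma continuous_on_compact_selection:
  fixes f :: "'a::euclidean_space \<Rightarrow> 'c::topological_space" and h :: "'a \<times> 'b::euclidean_space \<Rightarrow> 'c"
  assumes "compact T" "closed R" "R \<subseteq> UNIV \<times> T" and "\<And>x. \<exists>q. (x, q) \<in> R"
    and cont: "continuous_on R h" and f: "\<And>x q. (x, q) \<in> R \<Longrightarrow> f x = h (x, q)"
  shows "continuous_on UNIV f"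
proof -
  have "closed (f -` U)" if "closed U" for U
  proof -
    have eq: "f -` U = fst ` (R \<inter> h -` U)"
      using assms(4) f by (force simp: image_iff)
    have "closed (R \<inter> h -` U)"
      by (intro continuous_closed_preimage cont that \<open>closed R\<close>)
    then have "closedin (top_of_set (UNIV \<times> T)) (R \<inter> h -` U)"
      using assms(3) by (intro closed_subset) auto
    then have "closedin (top_of_set UNIV) (fst ` (R \<inter> h -` U))"
      by (rule Starlike.closed_map_fst[OF \<open>compact T\<close>])
    then show ?thesis by (simp add: eq)
  qed
  then show ?thesis by (simp add: continuous_on_closed_vimage)
qed

lemma continuous_on_matrix_matrix_mult [continuous_intros]:
  fixes f :: "'a::topological_space \<Rightarrow> real^'n^'m" and g :: "'a \<Rightarrow> real^'k^'n"
  assumes "continuous_on S f" "continuous_on S g"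
  shows "continuous_on S (\<lambda>x. f x ** g x)"
  unfolding matrix_matrix_mult_def by (intro continuous_intros assms)

lemma continuous_on_matrix_vector_mult [continuous_intros]:
  fixes f :: "'a::topological_space \<Rightarrow> real^'n^'m" and g :: "'a \<Rightarrow> real^'n"
  assumes "continuous_on S f" "continuous_on S g"
  shows "continuous_on S (\<lambda>x. f x *v g x)"
  unfolding matrix_vector_mult_def by (intro continuous_intros assms)

lemma continuous_on_transpose [continuous_intros]:
  fixes f :: "'a::topological_space \<Rightarrow> real^'n^'m"
  assumes "continuous_on S f"
  shows "continuous_on S (\<lambda>x. transpose (f x))"
  unfolding transpose_def by (intro continuous_intros assms)

lemma continuous_on_diag_matrix [continuous_intros]:
  assumes "continuous_on S f"
  shows "continuous_on S (\<lambda>x. diag_matrix (f x :: real^'n))"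
proof -
  have "continuous_on S (\<lambda>x. if i = j then f x $ i else 0)" for i j
    by (cases "i = j") (auto intro!: continuous_intros assms)
  then show ?thesis unfolding diag_matrix_def by (intro continuous_intros)
qed

lemma compact_orthogonal_matrices: "compact {Q :: real^'n^'n. orthogonal_matrix Q}"
proof -
  have "closed {Q :: real^'n^'n. transpose Q ** Q = mat 1}"
    by (intro closed_Collect_eq continuous_intros)
  moreover have "bounded {Q :: real^'n^'n. orthogonal_matrix Q}"
  proof -
    have "norm Q \<le> real CARD('n)" if "orthogonal_matrix Q" for Q :: "real^'n^'n"
    proof -
      have "norm (Q $ i) = 1" for i
        using that by (simp add: orthogonal_matrix_orthonormal_rows row_def)
      then show ?thesis
        using L2_set_le_sum[of UNIV "\<lambda>i. norm (Q $ i)"] by (simp add: norm_vec_def)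
    qed
    then show ?thesis by (auto simp: bounded_iff)
  qed
  ultimately show ?thesis by (simp add: compact_eq_bounded_closed orthogonal_matrix)
qed

text \<open>The witness is a diagonalizing orthogonal matrix, taken from a compact set. Positive
  eigenvalues are needed since \<open>t powr s\<close> is continuous only away from 0 for general
  \<open>s\<close>.\<close>

lemma continuous_on_matrix_powr_posdef:
  fixes A :: "'a::euclidean_space \<Rightarrow> real^'n^'n"
  assumes cont: "continuous_on UNIV A" and sym: "\<And>x. transpose (A x) = A x"
    and pos: "\<And>x v. v \<noteq> 0 \<Longrightarrow> 0 < v \<bullet> (A x *v v)"
  shows "continuous_on UNIV (\<lambda>x. matrix_powr (A x) s)"
proof -
  \<comment> \<open>Eigenvalues are read off the conjugated matrix, so that they are continuous in
    the pair \<open>(x, Q)\<close>.\<close>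
  define d where "d = (\<lambda>(x, Q :: real^'n^'n). \<chi> i. (Q ** A x ** transpose Q) $ i $ i)"
  define R where "R = {(x, Q). orthogonal_matrix Q \<and> Q ** A x ** transpose Q = diag_matrix (d (x, Q))}"
  define h where "h = (\<lambda>p. transpose (snd p) ** diag_matrix (\<chi> i. (d p $ i) powr s) ** snd p)"
  have contA: "continuous_on S (\<lambda>p. A (fst p))" for S :: "('a \<times> (real^'n^'n)) set"
    by (rule continuous_on_compose2[OF cont]) (auto intro: continuous_intros)
  have contd: "continuous_on S d" for S
    unfolding d_def case_prod_beta by (intro continuous_intros contA)
  have diag: "A x = transpose Q ** diag_matrix (d (x, Q)) ** Q" if "(x, Q) \<in> R" for x Q
  proof -
    have Q: "transpose Q ** Q = mat 1" using that by (simp add: R_def orthogonal_matrix)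
    have "transpose Q ** diag_matrix (d (x, Q)) ** Q = transpose Q ** (Q ** A x ** transpose Q) ** Q"
      using that by (simp add: R_def)
    also have "\<dots> = (transpose Q ** Q) ** A x ** (transpose Q ** Q)"
      by (simp add: matrix_mul_assoc)
    finally show ?thesis by (simp add: Q)
  qed
  \<comment> \<open>Each eigenvalue has the sign of the form at the corresponding column of
    \<open>transpose Q\<close>.\<close>
  have dpos: "0 < d (x, Q) $ i" if "(x, Q) \<in> R" for x Q i
  proof -
    have Q: "orthogonal_matrix Q" using that by (simp add: R_def)
    let ?v = "transpose Q *v axis i 1"
    have Qv: "Q *v ?v = axis i 1"
      using Q by (simp add: matrix_vector_mul_assoc orthogonal_matrix_def)
    then have "?v \<noteq> 0" by (metis axis_eq_0_iff matrix_vector_mult_0_right zero_neq_one)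
    from pos[OF this] have "0 < ?v \<bullet> (A x *v ?v)" .
    also have "A x *v ?v = transpose Q *v (\<chi> j. d (x, Q) $ j * axis i 1 $ j)"
      by (subst diag[OF that]) (simp only: diagonalized_mult_vec Qv)
    also have "(\<chi> j. d (x, Q) $ j * axis i 1 $ j) = d (x, Q) $ i *\<^sub>R axis i (1::real)"
      by (simp add: vec_eq_iff axis_def)
    also have "transpose Q *v (d (x, Q) $ i *\<^sub>R axis i (1::real)) = d (x, Q) $ i *\<^sub>R ?v"
      by (simp only: matrix_vector_mult_scaleR)
    finally have "0 < d (x, Q) $ i * (?v \<bullet> ?v)" by simp
    then show ?thesis by (metis inner_ge_zero linorder_not_le mult_nonpos_nonneg)
  qed
  show ?thesis
  proof (rule continuous_on_compact_selection[OF compact_orthogonal_matrices, of R])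
    have "R = {p. transpose (snd p) ** snd p = mat 1} \<inter>
        {p. snd p ** A (fst p) ** transpose (snd p) = diag_matrix (d p)}"
      by (auto simp: R_def orthogonal_matrix)
    then show "closed R"
      by (simp only:) (intro closed_Int closed_Collect_eq continuous_intros contA contd)
    show "R \<subseteq> UNIV \<times> {Q. orthogonal_matrix Q}" by (auto simp: R_def)
    show "\<exists>Q. (x, Q) \<in> R" for x
    proof -
      obtain Q d' where Q: "orthogonal_matrix Q" "A x = transpose Q ** diag_matrix d' ** Q"
        using symmetric_diagonalization[OF sym] by metis
      have "Q ** A x ** transpose Q = (Q ** transpose Q) ** diag_matrix d' ** (Q ** transpose Q)"
        by (simp add: Q(2) matrix_mul_assoc)
      then have "Q ** A x ** transpose Q = diag_matrix d'"
        using Q(1) by (simp add: orthogonal_matrix_def)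
      moreover from this have "d (x, Q) = d'" by (simp add: d_def diag_matrix_def vec_eq_iff)
      ultimately show ?thesis using Q(1) by (auto simp: R_def)
    qed
    show "continuous_on R h"
      unfolding h_def
      by (intro continuous_intros contd) (metis dpos less_irrefl prod.exhaust)
    show "matrix_powr (A x) s = h (x, Q)" if "(x, Q) \<in> R" for x Q
      using matrix_powr_diagonalized[OF _ diag[OF that]] that by (simp add: h_def R_def)
  qed
qed

section \<open>Symmetric matrix families with a fixed one-dimensional kernel\<close>

locale line_kernel_family =
  fixes A :: "'a::euclidean_space \<Rightarrow> real^'n::finite^'n" and u :: "real^'n"
  assumes cont: "continuous_on UNIV A" and sym: "transpose (A x) = A x"
    and u_nonzero: "u \<noteq> 0" and kernel: "A x *v u = 0"
    and pos: "v \<noteq> 0 \<Longrightarrow> u \<bullet> v = 0 \<Longrightarrow> 0 < v \<bullet> (A x *v v)"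
begin

lemma form_split: "v \<bullet> (A x *v v) = (v - c *\<^sub>R u) \<bullet> (A x *v (v - c *\<^sub>R u))"
proof -
  have "A x *v (v - c *\<^sub>R u) = A x *v v"
    by (simp add: matrix_vector_mult_diff_distrib matrix_vector_mult_scaleR kernel)
  moreover have "u \<bullet> (A x *v v) = 0"
    using symmetric_matrix_dot[OF sym, of x u v] kernel by simp
  ultimately show ?thesis by (simp add: inner_diff_left)
qed

lemma orthogonal_part: "u \<bullet> (v - ((u \<bullet> v) / (u \<bullet> u)) *\<^sub>R u) = 0"
  using u_nonzero by (simp add: inner_diff_right)

lemma nonneg: "0 \<le> v \<bullet> (A x *v v)"
  using pos[OF _ orthogonal_part[of v], of x] form_split[of v x "(u \<bullet> v) / (u \<bullet> u)"]
  by (cases "v - ((u \<bullet> v) / (u \<bullet> u)) *\<^sub>R u = 0") auto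

lemma kernel_line: "A x *v v = 0 \<Longrightarrow> v = ((u \<bullet> v) / (u \<bullet> u)) *\<^sub>R u"
  using pos[OF _ orthogonal_part[of v], of x] form_split[of v x "(u \<bullet> v) / (u \<bullet> u)"]
  by (cases "v - ((u \<bullet> v) / (u \<bullet> u)) *\<^sub>R u = 0") auto

text \<open>The convention \<open>0 powr s = 0\<close> keeps \<open>u\<close> in the kernel of every
  power, including \<open>s \<le> 0\<close>; by symmetry the range is then orthogonal to
  \<open>u\<close>, which makes the fractional field tangent to the hyperplane.\<close>

lemma orthogonal_range_powr: "u \<bullet> (matrix_powr (A x) s *v v) = 0"
proof -
  have "matrix_powr (A x) s *v u = (0 powr s) *\<^sub>R u"
    by (rule matrix_powr_eigenvector[OF sym]) (simp add: kernel)
  then show ?thesis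
    using symmetric_matrix_dot[OF transpose_matrix_powr[OF sym], of x s u v] by simp
qed

lemma powr_pos:
  assumes "v \<noteq> 0" "u \<bullet> v = 0"
  shows "0 < v \<bullet> (matrix_powr (A x) s *v v)"
proof -
  have "A x *v v \<noteq> 0" using pos[OF assms, of x] by auto
  then show ?thesis using matrix_powr_nonneg[OF sym, of v x s] by fastforce
qed

text \<open>Zero is an isolated eigenvalue of constant multiplicity: shifting it to 1 by adding the
  projection \<open>P\<close> onto the kernel reduces the claim to the positive definite case.\<close>

lemma continuous_matrix_powr: "continuous_on UNIV (\<lambda>x. matrix_powr (A x) s)"
proof -
  define P :: "real^'n^'n" where "P = (\<chi> i j. u $ i * u $ j / (u \<bullet> u))"
  have P: "P *v v = ((u \<bullet> v) / (u \<bullet> u)) *\<^sub>R u" for v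
    by (simp add: P_def matrix_vector_mult_def vec_eq_iff inner_vec_def sum_divide_distrib
      sum_distrib_left sum_distrib_right mult_ac)
  have symP: "transpose (A x + P) = A x + P" for x
    using sym[of x] by (simp add: transpose_def P_def vec_eq_iff mult.commute)
  \<comment> \<open>On the kernel, the shifted matrix has eigenvalue 1 and
    \<open>1 powr s - 1 = 0 = 0 powr s\<close>; other eigenvectors are orthogonal to
    \<open>u\<close> and do not feel \<open>P\<close>.\<close>
  have "matrix_powr (A x) s = matrix_powr (A x + P) s - P" for x
  proof (rule matrix_eqI_eigenvectors[OF sym[of x]])
    fix v c assume v: "A x *v v = c *\<^sub>R v"
    have diff: "(matrix_powr (A x + P) s - P) *v v = matrix_powr (A x + P) s *v v - P *v v"
      by (simp add: matrix_vector_mult_diff_rdistrib)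
    show "matrix_powr (A x) s *v v = (matrix_powr (A x + P) s - P) *v v"
    proof (cases "c = 0")
      case True
      then have "P *v v = v" using kernel_line[of x v] v P[of v] by simp
      moreover have "(A x + P) *v v = 1 *\<^sub>R v"
        using v True calculation by (simp add: matrix_vector_mult_add_rdistrib)
      ultimately show ?thesis
        using matrix_powr_eigenvector[OF sym v, of s] matrix_powr_eigenvector[OF symP, of x v 1 s]
          True diff by simp
    next
      case False
      have "c * (u \<bullet> v) = 0"
        using symmetric_matrix_dot[OF sym, of x u v] kernel v by simp
      then have "P *v v = 0" using False P[of v] by simp
      moreover have "(A x + P) *v v = c *\<^sub>R v"
        using v calculation by (simp add: matrix_vector_mult_add_rdistrib)
      ultimately show ?thesis
        using matrix_powr_eigenvector[OF sym v, of s] matrix_powr_eigenvector[OF symP, of x v c s] diff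
        by simp
    qed
  qed
  moreover have "continuous_on UNIV (\<lambda>x. matrix_powr (A x + P) s)"
  proof (rule continuous_on_matrix_powr_posdef)
    show "continuous_on UNIV (\<lambda>x. A x + P)" by (intro continuous_intros cont)
    show "0 < v \<bullet> ((A x + P) *v v)" if "v \<noteq> 0" for x v
    proof (cases "u \<bullet> v = 0")
      case True
      then show ?thesis using pos[OF that True, of x] by (simp add: matrix_vector_mult_add_rdistrib P)
    next
      case False
      have "0 < (u \<bullet> v)\<^sup>2 / (u \<bullet> u)" using False u_nonzero by simp
      then show ?thesis using nonneg[of v x]
        by (simp add: matrix_vector_mult_add_rdistrib P inner_add_right power2_eq_square inner_commute)
    qed
  qed (rule symP)
  ultimately show ?thesis by (simp add: continuous_on_diff)
qed

end

section \<open>Dirichlet forms and the curvature map\<close>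

lemma has_derivative_vec:
  fixes f :: "'a::real_normed_vector \<Rightarrow> real^'n"
  assumes "\<And>i. ((\<lambda>x. f x $ i) has_derivative (\<lambda>h. f' h $ i)) (at a)"
  shows "(f has_derivative f') (at a)"
  unfolding has_derivative_componentwise_within[of f f' a UNIV]
  using assms by (auto simp: Basis_vec_def inner_axis)

lemma flux_sum_zero:
  fixes K :: "'n::finite \<Rightarrow> 'n \<Rightarrow> real" and \<phi> :: "real \<Rightarrow> real"
  assumes sym: "\<And>i j. K i j = K j i" and odd: "\<And>t. \<phi> (- t) = - \<phi> t"
  shows "(\<Sum>i\<in>UNIV. \<Sum>j\<in>UNIV. K i j * \<phi> (g j - g i)) = 0"
proof -
  have "(\<Sum>i\<in>UNIV. \<Sum>j\<in>UNIV. K i j * \<phi> (g j - g i)) = (\<Sum>j\<in>UNIV. \<Sum>i\<in>UNIV. K i j * \<phi> (g j - g i))"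
    by (rule sum.swap)
  also have "\<dots> = (\<Sum>j\<in>UNIV. \<Sum>i\<in>UNIV. - (K j i * \<phi> (g i - g j)))"
  proof (intro sum.cong refl)
    show "K i j * \<phi> (g j - g i) = - (K j i * \<phi> (g i - g j))" for i j
      using odd[of "g i - g j"] sym[of i j] by (simp del: minus_diff_eq add: minus_diff_eq[symmetric, of "g j"])
  qed
  finally show ?thesis by (simp add: sum_negf)
qed

text \<open>Summation by parts: swapping the indices flips the sign of the flux, so the two halves
  of the symmetrized sum agree. A general odd \<open>\<phi>\<close> treats the Hessian, with
  \<open>\<phi> t = t\<close>, and the \<open>p\<close>-Laplacian together.\<close>

lemma dirichlet_form:
  fixes K :: "'n::finite \<Rightarrow> 'n \<Rightarrow> real" and \<phi> :: "real \<Rightarrow> real"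
  assumes sym: "\<And>i j. K i j = K j i" and odd: "\<And>t. \<phi> (- t) = - \<phi> t"
  shows "(\<Sum>i\<in>UNIV. g i * (\<Sum>j\<in>UNIV. K i j * \<phi> (g j - g i)))
    = - (\<Sum>i\<in>UNIV. \<Sum>j\<in>UNIV. K i j * (\<phi> (g j - g i) * (g j - g i))) / 2"
proof -
  let ?S = "\<Sum>i\<in>UNIV. \<Sum>j\<in>UNIV. K i j * (\<phi> (g j - g i) * g i)"
  have "?S = (\<Sum>j\<in>UNIV. \<Sum>i\<in>UNIV. K i j * (\<phi> (g j - g i) * g i))" by (rule sum.swap)
  also have "\<dots> = (\<Sum>j\<in>UNIV. \<Sum>i\<in>UNIV. - (K j i * (\<phi> (g i - g j) * g i)))"
  proof (intro sum.cong refl)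
    show "K i j * (\<phi> (g j - g i) * g i) = - (K j i * (\<phi> (g i - g j) * g i))" for i j
      using odd[of "g i - g j"] sym[of i j] by (simp del: minus_diff_eq add: minus_diff_eq[symmetric, of "g j"])
  qed
  finally have swap: "?S = - (\<Sum>j\<in>UNIV. \<Sum>i\<in>UNIV. K j i * (\<phi> (g i - g j) * g i))"
    by (simp add: sum_negf)
  have "(\<Sum>i\<in>UNIV. \<Sum>j\<in>UNIV. K i j * (\<phi> (g j - g i) * (g j - g i)))
      = (\<Sum>i\<in>UNIV. \<Sum>j\<in>UNIV. K i j * (\<phi> (g j - g i) * g j)) - ?S"
    by (simp add: right_diff_distrib sum_subtractf)
  also have "\<dots> = - 2 * ?S" using swap by simp
  finally have "?S = - (\<Sum>i\<in>UNIV. \<Sum>j\<in>UNIV. K i j * (\<phi> (g j - g i) * (g j - g i))) / 2" by simp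
  then show ?thesis by (simp add: sum_distrib_left mult_ac)
qed

lemma dirichlet_form_zero:
  fixes K :: "'n::finite \<Rightarrow> 'n \<Rightarrow> real" and \<phi> :: "real \<Rightarrow> real"
  assumes "\<And>i j. 0 \<le> K i j" and "\<And>t. t \<noteq> 0 \<Longrightarrow> 0 < \<phi> t * t"
    and "(\<Sum>i\<in>UNIV. \<Sum>j\<in>UNIV. K i j * (\<phi> (g j - g i) * (g j - g i))) \<le> 0" and "0 < K i j"
  shows "g i = g j"
proof (rule ccontr)
  assume "g i \<noteq> g j"
  let ?f = "\<lambda>i j. K i j * (\<phi> (g j - g i) * (g j - g i))"
  have nn: "0 \<le> ?f i j" for i j
    using assms(1)[of i j] assms(2)[of "g j - g i"] by (cases "g j - g i = 0") (auto intro: mult_nonneg_nonneg less_imp_le)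
  have "0 < ?f i j" using assms(2)[of "g j - g i"] \<open>0 < K i j\<close> \<open>g i \<noteq> g j\<close> by simp
  also have "\<dots> \<le> (\<Sum>j\<in>UNIV. ?f i j)" by (rule member_le_sum) (use nn in auto)
  also have "\<dots> \<le> (\<Sum>i\<in>UNIV. \<Sum>j\<in>UNIV. ?f i j)"
    by (rule member_le_sum[where f = "\<lambda>i. \<Sum>j\<in>UNIV. ?f i j"]) (use nn in \<open>auto intro: sum_nonneg\<close>)
  finally show False using assms(3) by simp
qed

lemma p_power_pos: "t \<noteq> 0 \<Longrightarrow> 0 < \<bar>t\<bar> powr (p - 2) * t * (t :: real)"
  by (metis mult.assoc mult_pos_pos not_real_square_gt_zero powr_gt_zero zero_less_abs_iff abs_eq_0)

text \<open>The exponent \<open>p - 2\<close> may be negative, so 0 is treated separately: there the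
  absolute value equals \<open>|t| powr (p - 1)\<close>, which tends to 0 because
  \<open>p > 1\<close>.\<close>

lemma continuous_p_power:
  assumes "1 < p"
  shows "continuous_on UNIV (\<lambda>t::real. \<bar>t\<bar> powr (p - 2) * t)"
proof -
  have "isCont (\<lambda>t::real. \<bar>t\<bar> powr (p - 2) * t) x" for x
  proof (cases "x = 0")
    case True
    have "((\<lambda>t::real. \<bar>t\<bar> powr (p - 1)) \<longlongrightarrow> \<bar>0\<bar> powr (p - 1)) (at 0)"
      by (rule tendsto_powr'[OF tendsto_rabs[OF tendsto_ident_at] tendsto_const])
        (use assms in \<open>auto intro: always_eventually\<close>)
    then have "((\<lambda>t::real. \<bar>t\<bar> powr (p - 1)) \<longlongrightarrow> 0) (at 0)" by simp
    moreover have "\<bar>\<bar>t\<bar> powr (p - 2) * t\<bar> = \<bar>t\<bar> powr (p - 1)" for t :: real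
      by (cases "t = 0") (use powr_add[of "\<bar>t\<bar>" "p - 2" 1] in \<open>simp_all add: abs_mult\<close>)
    ultimately have "((\<lambda>t::real. \<bar>t\<bar> powr (p - 2) * t) \<longlongrightarrow> 0) (at 0)"
      by (subst tendsto_rabs_zero_iff[symmetric]) simp
    with True show ?thesis by (simp add: isCont_def)
  next
    case False
    then show ?thesis by (intro continuous_intros) auto
  qed
  then show ?thesis by (simp add: continuous_at_imp_continuous_on)
qed

section \<open>Curvature on a connected graph with enumerated edges\<close>

locale edge_enumeration =
  fixes V :: "'v set" and E :: "'v set set" and e :: "'n::finite \<Rightarrow> 'v set"
  assumes graph: "simple_graph V E" and conn: "connected_graph V E" and enum: "bij_betw e UNIV E"
begin

lemma edge_in: "e i \<in> E"
  using enum by (auto simp: bij_betw_def)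

lemma edge_index: "f \<in> E \<Longrightarrow> \<exists>i. f = e i"
  using enum by (auto simp: bij_betw_def)

lemma card_edge: "card (e i) = 2"
  using graph edge_in by (auto simp: simple_graph_def)

lemma finite_edge [simp]: "finite (e i)"
  using card_edge[of i] card.infinite by fastforce

lemma finite_V: "finite V" and edge_subset: "e i \<subseteq> V"
  using graph edge_in by (auto simp: simple_graph_def)

lemma vertex_covered:
  assumes "x \<in> V"
  shows "\<exists>i. x \<in> e i"
proof -
  obtain y where y: "y \<in> V" "y \<noteq> x"
  proof -
    \<comment> \<open>Index types are inhabited, so there is an edge; with its two endpoints
      \<open>V\<close> cannot be just \<open>{x}\<close>, and a path from \<open>x\<close> to
      another vertex starts with an edge at \<open>x\<close>.\<close>
    obtain i :: 'n where True by simp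
    have "\<not> e i \<subseteq> {x}" using card_edge[of i] card_mono[of "{x}" "e i"] by auto
    then show thesis using that edge_subset[of i] by blast
  qed
  then have "(x, y) \<in> {(u, v). {u, v} \<in> E}\<^sup>*"
    using conn assms by (auto simp: connected_graph_def)
  then obtain z where "{x, z} \<in> E"
    using y(2) by (cases rule: converse_rtranclE) auto
  then show ?thesis using edge_index by blast
qed

text \<open>The line graph of a connected graph is connected. Along a vertex path the invariant is
  that all edges at the current vertex carry the value \<open>g i\<close>.\<close>

lemma adjacent_constant:
  assumes adj: "\<And>i j. e i \<inter> e j \<noteq> {} \<Longrightarrow> g i = g j"
  shows "g i = g j"
proof -
  obtain x where x: "x \<in> e i" using card_edge[of i] by fastforce
  obtain y where y: "y \<in> e j" using card_edge[of j] by fastforce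
  have "(x, y) \<in> {(u, v). {u, v} \<in> E}\<^sup>*"
    using conn x y edge_subset[of i] edge_subset[of j] unfolding connected_graph_def by blast
  then have "\<forall>k. y \<in> e k \<longrightarrow> g k = g i"
  proof (induction rule: rtrancl_induct)
    case base
    then show ?case using adj x by blast
  next
    case (step y z)
    then have "{y, z} \<in> E" by simp
    then obtain l where l: "{y, z} = e l" using edge_index by blast
    then have "g l = g i" using step by blast
    moreover have "g k = g l" if "z \<in> e k" for k using adj[of k l] l that by blast
    ultimately show ?case by simp
  qed
  then show ?thesis using y by metis
qed

lemma vertex_weight_pos: "x \<in> e i \<Longrightarrow> 0 < vertex_weight e r x"
  unfolding vertex_weight_def by (rule sum_pos) auto

lemma vertex_weight_pos': "x \<in> V \<Longrightarrow> 0 < vertex_weight e r x"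
  using vertex_covered vertex_weight_pos by blast

lemma vertex_weight_has_derivative:
  "((\<lambda>r. vertex_weight e r x) has_derivative (\<lambda>v. \<Sum>j | x \<in> e j. exp (r $ j) * v $ j)) (at r)"
proof -
  have "((\<lambda>r::real^'n. exp (r $ j)) has_derivative (\<lambda>v. exp (r $ j) * v $ j)) (at r)" for j
    by (auto intro!: derivative_eq_intros bounded_linear.has_derivative[OF bounded_linear_vec_nth])
  then show ?thesis unfolding vertex_weight_def by (intro has_derivative_sum)
qed

lemma sum_incidences:
  "(\<Sum>x\<in>V. \<Sum>i | x \<in> e i. f x i) = (\<Sum>i\<in>UNIV. \<Sum>x\<in>e i. f x i)"
proof -
  have "(\<Sum>x\<in>V. \<Sum>i | x \<in> e i. f x i) = (\<Sum>i\<in>UNIV. \<Sum>x | x \<in> V \<and> x \<in> e i. f x i)"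
    using sum.swap_restrict[OF finite_V, of "UNIV :: 'n set" f "\<lambda>x i. x \<in> e i"] by simp
  moreover have "{x. x \<in> V \<and> x \<in> e i} = e i" for i using edge_subset by blast
  ultimately show ?thesis by simp
qed

lemma curvature_component: "curvature e r $ i = (\<Sum>x\<in>e i. 2 * exp (r $ i) / vertex_weight e r x) - 2"
  by (simp add: curvature_def sum_distrib_left)

text \<open>Gauss-Bonnet: summed by vertices instead of edges, each vertex contributes
  \<open>2 * m x / m x = 2\<close> and each edge contributes \<open>-2\<close>.\<close>

lemma sum_curvature: "(\<Sum>i\<in>UNIV. curvature e r $ i) = 2 * (real (card V) - real (card E))"
proof -
  have "(\<Sum>i\<in>UNIV. \<Sum>x\<in>e i. 2 * exp (r $ i) / vertex_weight e r x)
      = (\<Sum>x\<in>V. \<Sum>i | x \<in> e i. 2 * exp (r $ i) / vertex_weight e r x)"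
    by (simp only: sum_incidences)
  also have "\<dots> = (\<Sum>x\<in>V. 2 * vertex_weight e r x / vertex_weight e r x)"
    by (intro sum.cong refl) (simp add: vertex_weight_def sum_divide_distrib sum_distrib_left)
  also have "\<dots> = (\<Sum>x\<in>V. 2)"
    using vertex_weight_pos' by (intro sum.cong refl) (simp add: less_imp_neq[symmetric])
  finally show ?thesis
    using bij_betw_same_card[OF enum] by (simp add: curvature_component sum_subtractf)
qed

lemma curvature_shift: "curvature e (r + (\<chi> i. c)) = curvature e r"
proof -
  have "vertex_weight e (r + (\<chi> i. c)) x = exp c * vertex_weight e r x" for x
    by (simp add: vertex_weight_def exp_add sum_distrib_left mult.commute)
  then show ?thesis
    by (simp add: curvature_component vec_eq_iff exp_add mult.commute)
qed

text \<open>Off the diagonal this is minus the entry of \<open>J\<close>, and it vanishes for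
  disjoint edges. The diagonal value is not an entry of \<open>J\<close>; it only ever multiplies a
  zero difference.\<close>

definition conductance :: "real^'n \<Rightarrow> 'n \<Rightarrow> 'n \<Rightarrow> real" where
  "conductance r i j = (\<Sum>x\<in>e i \<inter> e j. 2 * exp (r $ i) * exp (r $ j) / (vertex_weight e r x)\<^sup>2)"

lemma conductance_sym: "conductance r i j = conductance r j i"
  by (simp add: conductance_def Int_commute mult_ac)

lemma conductance_nonneg: "0 \<le> conductance r i j"
  unfolding conductance_def by (rule sum_nonneg) simp

lemma conductance_pos: "e i \<inter> e j \<noteq> {} \<Longrightarrow> 0 < conductance r i j"
  unfolding conductance_def
  by (rule sum_pos) (auto dest: vertex_weight_pos[of _ _ r] intro!: divide_pos_pos)

definition hess :: "real^'n \<Rightarrow> real^'n \<Rightarrow> real^'n" where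
  "hess r v = (\<chi> i. \<Sum>j\<in>UNIV. conductance r i j * (v $ i - v $ j))"

lemma curvature_has_derivative: "(curvature e has_derivative hess r) (at r)"
proof (rule has_derivative_vec)
  fix i
  let ?m = "vertex_weight e r"
  have "((\<lambda>r. 2 * exp (r $ i) / vertex_weight e r x) has_derivative
      (\<lambda>v. \<Sum>j | x \<in> e j. 2 * exp (r $ i) * exp (r $ j) / (?m x)\<^sup>2 * (v $ i - v $ j))) (at r)"
    if "x \<in> e i" for x
  proof -
    have m: "?m x \<noteq> 0" using vertex_weight_pos[OF that, of r] by simp
    have "((\<lambda>r. 2 * exp (r $ i) / vertex_weight e r x) has_derivative
      (\<lambda>v. (2 * (exp (r $ i) * v $ i) * ?m x - 2 * exp (r $ i) * (\<Sum>j | x \<in> e j. exp (r $ j) * v $ j))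
        / (?m x * ?m x))) (at r)"
      by (rule has_derivative_divide'[OF _ vertex_weight_has_derivative m])
        (auto intro!: derivative_eq_intros bounded_linear.has_derivative[OF bounded_linear_vec_nth])
    moreover have "(2 * (exp (r $ i) * v $ i) * ?m x
          - 2 * exp (r $ i) * (\<Sum>j | x \<in> e j. exp (r $ j) * v $ j)) / (?m x * ?m x)
        = (\<Sum>j | x \<in> e j. 2 * exp (r $ i) * exp (r $ j) / (?m x)\<^sup>2 * (v $ i - v $ j))" for v
    proof -
      \<comment> \<open>Expanding the total weight in the first product over the edges at
        \<open>x\<close> lets the two terms of the quotient rule combine into differences
        \<open>v $ i - v $ j\<close>.\<close>
      have "2 * (exp (r $ i) * v $ i) * ?m x = (\<Sum>j | x \<in> e j. 2 * exp (r $ i) * exp (r $ j) * v $ i)"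
        unfolding vertex_weight_def sum_distrib_left by (intro sum.cong) auto
      then show ?thesis
        by (simp add: sum_distrib_left sum_subtractf[symmetric] sum_divide_distrib power2_eq_square
          algebra_simps)
    qed
    ultimately show ?thesis by simp
  qed
  then have "((\<lambda>r. curvature e r $ i) has_derivative (\<lambda>v. (\<Sum>x\<in>e i. \<Sum>j | x \<in> e j.
      2 * exp (r $ i) * exp (r $ j) / (?m x)\<^sup>2 * (v $ i - v $ j)) - 0)) (at r)"
    unfolding curvature_component by (intro has_derivative_diff has_derivative_sum has_derivative_const)
  moreover have "(\<Sum>x\<in>e i. \<Sum>j | x \<in> e j.
      2 * exp (r $ i) * exp (r $ j) / (?m x)\<^sup>2 * (v $ i - v $ j)) = hess r v $ i" for v
  proof -
    have "(\<Sum>x\<in>e i. \<Sum>j | x \<in> e j. 2 * exp (r $ i) * exp (r $ j) / (?m x)\<^sup>2 * (v $ i - v $ j))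
        = (\<Sum>j\<in>UNIV. \<Sum>x | x \<in> e i \<and> x \<in> e j.
            2 * exp (r $ i) * exp (r $ j) / (?m x)\<^sup>2 * (v $ i - v $ j))"
      using sum.swap_restrict[of "e i" "UNIV :: 'n set"
        "\<lambda>x j. 2 * exp (r $ i) * exp (r $ j) / (?m x)\<^sup>2 * (v $ i - v $ j)" "\<lambda>x j. x \<in> e j"] by simp
    then show ?thesis
      by (simp add: hess_def conductance_def sum_distrib_right Int_def)
  qed
  ultimately show "((\<lambda>r. curvature e r $ i) has_derivative (\<lambda>v. hess r v $ i)) (at r)" by simp
qed

lemma continuous_vertex_weight [continuous_intros]:
  "continuous_on S f \<Longrightarrow> continuous_on S (\<lambda>y. vertex_weight e (f y) x)"
  unfolding vertex_weight_def by (intro continuous_intros)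

lemma continuous_conductance [continuous_intros]:
  assumes "continuous_on S f"
  shows "continuous_on S (\<lambda>y. conductance (f y) i j)"
  unfolding conductance_def
  by (intro continuous_intros assms)
    (auto simp: less_imp_neq[OF vertex_weight_pos, symmetric])

lemma continuous_hess [continuous_intros]:
  assumes "continuous_on S f" "continuous_on S h"
  shows "continuous_on S (\<lambda>y. hess (f y) (h y))"
  unfolding hess_def by (intro continuous_intros assms)

lemma continuous_curvature: "continuous_on UNIV (curvature e)"
  using curvature_has_derivative
  by (meson continuous_at_imp_continuous_on has_derivative_continuous)

lemma J_eq: "J e r = matrix (hess r)"
  unfolding J_def jacobian_def using frechet_derivative_at[OF curvature_has_derivative] by simp

lemma J_mult: "J e r *v v = hess r v"
  unfolding J_eq by (rule matrix_works)
    (use has_derivative_linear[OF curvature_has_derivative] in \<open>simp add: linear_matrix_vector_mul_eq\<close>)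

lemma J_offdiag: "i \<noteq> j \<Longrightarrow> J e r $ i $ j = - conductance r i j"
  by (simp add: J_eq matrix_def hess_def axis_def if_distrib sum_negf cong: if_cong)

lemma hess_form: "v \<bullet> hess r v
    = (\<Sum>i\<in>UNIV. \<Sum>j\<in>UNIV. conductance r i j * ((v $ j - v $ i) * (v $ j - v $ i))) / 2"
proof -
  have "v \<bullet> hess r v = - (\<Sum>i\<in>UNIV. v $ i * (\<Sum>j\<in>UNIV. conductance r i j * (v $ j - v $ i)))"
    by (simp add: inner_vec_def hess_def sum_negf[symmetric] sum_distrib_left algebra_simps)
  then show ?thesis
    using dirichlet_form[of "conductance r" "\<lambda>t. t" "($) v", OF conductance_sym] by simp
qed

text \<open>A vanishing form equates the values on adjacent edges, connectedness makes
  \<open>g\<close> constant, and zero sum makes the constant 0.\<close>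

lemma constant_of_form_zero:
  assumes \<phi>: "\<And>t. t \<noteq> 0 \<Longrightarrow> 0 < \<phi> t * t"
    and le: "(\<Sum>i\<in>UNIV. \<Sum>j\<in>UNIV. conductance r i j * (\<phi> (g $ j - g $ i) * (g $ j - g $ i))) \<le> 0"
    and sum: "(\<chi> i. 1) \<bullet> g = 0"
  shows "g = 0"
proof -
  have "g $ i = g $ j" for i j
    by (rule adjacent_constant, rule dirichlet_form_zero[OF conductance_nonneg \<phi> le conductance_pos])
  then have "g $ i = 0" for i
  proof -
    have "(\<chi> i. 1) \<bullet> g = (\<Sum>j\<in>(UNIV::'n set). g $ i)"
      unfolding inner_vec_def using \<open>\<And>i j. g $ i = g $ j\<close> by (intro sum.cong refl) simp
    then show ?thesis using sum by simp
  qed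
  then show ?thesis by (simp add: vec_eq_iff)
qed

lemma hess_pos:
  assumes "v \<noteq> 0" "(\<chi> i. 1) \<bullet> v = 0"
  shows "0 < v \<bullet> hess r v"
proof (rule ccontr)
  assume "\<not> ?thesis"
  then show False
    using constant_of_form_zero[of "\<lambda>t. t" r v] assms
    by (force simp: hess_form linorder_not_less zero_less_mult_iff linorder_neq_iff)
qed

sublocale line_kernel_family "J e" "\<chi> i. 1"
proof
  show "continuous_on UNIV (J e)"
    unfolding J_eq matrix_def by (intro continuous_intros)
  show "transpose (J e r) = J e r" for r
    by (simp add: vec_eq_iff transpose_def)
      (metis J_offdiag conductance_sym)
  show "(\<chi> i. 1) \<noteq> (0 :: real^'n)" by (simp add: vec_eq_iff)
  show "J e r *v (\<chi> i. 1) = 0" for r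
    by (simp add: J_mult hess_def vec_eq_iff)
qed (simp add: J_mult hess_pos)

text \<open>Each logarithm differentiates to the quotients \<open>2 * exp (r $ i) / m x\<close> in
  the curvature; the 2 in the linear coefficient is the constant \<open>-2\<close> there.\<close>

definition potential :: "real^'n \<Rightarrow> real^'n \<Rightarrow> real" where
  "potential k r = (\<Sum>x\<in>V. 2 * ln (vertex_weight e r x)) - (\<Sum>i\<in>UNIV. (2 + k $ i) * r $ i)"

lemma potential_has_derivative:
  "(potential k has_derivative (\<lambda>v. (curvature e r - k) \<bullet> v)) (at r)"
proof -
  let ?m = "vertex_weight e r"
  have "((\<lambda>r. 2 * ln (vertex_weight e r x)) has_derivative
      (\<lambda>v. \<Sum>i | x \<in> e i. 2 * exp (r $ i) / ?m x * v $ i)) (at r)" if "x \<in> V" for x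
  proof -
    have "((\<lambda>r. 2 * ln (vertex_weight e r x)) has_derivative
        (\<lambda>v. 2 * ((\<Sum>i | x \<in> e i. exp (r $ i) * v $ i) * (1 / ?m x)))) (at r)"
      using vertex_weight_pos'[OF that, of r]
      by (auto intro!: derivative_eq_intros vertex_weight_has_derivative simp: divide_inverse)
    then show ?thesis
      by (simp add: sum_distrib_left sum_distrib_right sum_divide_distrib mult_ac)
  qed
  then have "(potential k has_derivative (\<lambda>v. (\<Sum>x\<in>V. \<Sum>i | x \<in> e i. 2 * exp (r $ i) / ?m x * v $ i)
      - (\<Sum>i\<in>UNIV. (2 + k $ i) * v $ i))) (at r)"
    unfolding potential_def
    by (intro has_derivative_diff has_derivative_sum has_derivative_mult_right
      bounded_linear.has_derivative[OF bounded_linear_vec_nth] has_derivative_ident)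
  moreover have "(\<Sum>x\<in>V. \<Sum>i | x \<in> e i. 2 * exp (r $ i) / ?m x * v $ i)
      - (\<Sum>i\<in>UNIV. (2 + k $ i) * v $ i) = (curvature e r - k) \<bullet> v" for v
    unfolding sum_incidences
    by (simp add: inner_vec_def curvature_component sum_subtractf[symmetric] sum_distrib_right
      left_diff_distrib distrib_right diff_diff_eq)
  ultimately show ?thesis by simp
qed

end

section \<open>The flow fields and their limits\<close>

context edge_enumeration
begin

text \<open>Summing over all edges adds only zeros: disjoint edges have zero conductance and
  \<open>j = i\<close> has zero difference. The general Dirichlet form identities then
  apply.\<close>

lemma p_laplace_component:
  "p_laplace e p r g $ i = (\<Sum>j\<in>UNIV. conductance r i j * (\<bar>g $ j - g $ i\<bar> powr (p - 2) * (g $ j - g $ i)))"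
proof -
  have "p_laplace e p r g $ i = (\<Sum>j | j \<noteq> i \<and> e j \<inter> e i \<noteq> {}.
      conductance r i j * (\<bar>g $ j - g $ i\<bar> powr (p - 2) * (g $ j - g $ i)))"
    unfolding p_laplace_def by (simp, intro sum.cong) (auto simp: J_offdiag)
  also have "\<dots> = (\<Sum>j\<in>UNIV. conductance r i j * (\<bar>g $ j - g $ i\<bar> powr (p - 2) * (g $ j - g $ i)))"
    by (rule sum.mono_neutral_left) (auto simp: conductance_def Int_commute)
  finally show ?thesis .
qed

lemma p_laplace_orthogonal: "(\<chi> i. 1) \<bullet> p_laplace e p r g = 0"
  using flux_sum_zero[of "conductance r" "\<lambda>t. \<bar>t\<bar> powr (p - 2) * t" "($) g", OF conductance_sym]
  by (simp add: inner_vec_def p_laplace_component)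

lemma p_laplace_form: "g \<bullet> p_laplace e p r g = - (\<Sum>i\<in>UNIV. \<Sum>j\<in>UNIV. conductance r i j *
    (\<bar>g $ j - g $ i\<bar> powr (p - 2) * (g $ j - g $ i) * (g $ j - g $ i))) / 2"
  using dirichlet_form[of "conductance r" "\<lambda>t. \<bar>t\<bar> powr (p - 2) * t" "($) g", OF conductance_sym]
  by (simp add: inner_vec_def p_laplace_component)

lemma p_laplace_dissipative: "g \<bullet> p_laplace e p r g \<le> 0"
proof -
  have "0 \<le> \<bar>t\<bar> powr (p - 2) * t * t" for t :: real
    using p_power_pos[of t p] by (cases "t = 0") auto
  then have "0 \<le> (\<Sum>i\<in>UNIV. \<Sum>j\<in>UNIV. conductance r i j *
      (\<bar>g $ j - g $ i\<bar> powr (p - 2) * (g $ j - g $ i) * (g $ j - g $ i)))"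
    by (intro sum_nonneg mult_nonneg_nonneg[OF conductance_nonneg])
  then show ?thesis by (simp add: p_laplace_form)
qed

lemma p_laplace_strictly_dissipative:
  assumes "(\<chi> i. 1) \<bullet> g = 0" "g \<noteq> 0"
  shows "g \<bullet> p_laplace e p r g < 0"
proof (rule ccontr)
  assume "\<not> ?thesis"
  then show False
    using constant_of_form_zero[of "\<lambda>t. \<bar>t\<bar> powr (p - 2) * t" r g, OF p_power_pos] assms
    by (simp add: p_laplace_form linorder_not_less)
qed

lemma continuous_p_calabi_field:
  assumes "1 < p"
  shows "continuous_on UNIV (p_calabi_field e k p)"
proof -
  have "continuous_on UNIV (\<lambda>r. p_laplace e p r (curvature e r - k) $ i)" for i
    unfolding p_laplace_component
    by (intro continuous_intros continuous_curvature
      continuous_on_compose2[OF continuous_p_power[OF assms]]) auto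
  then have "continuous_on UNIV (\<lambda>r. \<chi> i. p_laplace e p r (curvature e r - k) $ i)"
    by (rule continuous_on_vec_lambda)
  then show ?thesis by (simp add: p_calabi_field_def[abs_def])
qed

lemma continuous_frac_calabi_field: "continuous_on UNIV (frac_calabi_field e k s)"
  unfolding frac_calabi_field_def[abs_def] frac_laplace_def
  by (intro continuous_intros continuous_matrix_powr continuous_curvature)

lemma calabi_field_eq_frac: "calabi_field e k = frac_calabi_field e k 1"
  by (simp add: fun_eq_iff calabi_field_def frac_calabi_field_def laplace_def frac_laplace_def
    matrix_powr_one[OF sym nonneg])

context
  fixes k :: "real^'n"
  assumes total: "(\<Sum>i\<in>UNIV. k $ i) = 2 * (real (card V) - real (card E))"
begin

lemma curvature_defect_sum: "(\<chi> i. 1) \<bullet> (curvature e r - k) = 0"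
  using sum_curvature[of r] total by (simp add: inner_vec_def sum_subtractf)

lemma convex_potentialI:
  assumes "curvature e a = k"
  shows "convex_potential (potential k) (\<lambda>r. curvature e r - k) hess (\<chi> i. 1) a"
proof
  show "(potential k has_derivative (\<lambda>v. (curvature e r - k) \<bullet> v)) (at r)" for r
    by (rule potential_has_derivative)
  show "((\<lambda>r. curvature e r - k) has_derivative hess r) (at r)" for r
    using has_derivative_diff[OF curvature_has_derivative has_derivative_const] by simp
  show "continuous_on UNIV (\<lambda>(r, v). hess r v)"
    unfolding case_prod_beta by (intro continuous_intros)
qed (use assms hess_pos in auto)

lemma frac_dissipative: "(curvature e r - k) \<bullet> frac_calabi_field e k s r \<le> 0"
  unfolding frac_calabi_field_def frac_laplace_def
  using matrix_powr_nonneg(1)[OF sym] by simp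

lemma frac_flow_converges:
  assumes "curvature e a = k" and "(\<chi> i. 1) \<bullet> r0 = (\<chi> i. 1) \<bullet> a"
  shows "flow_converges_exp (frac_calabi_field e k s) r0 a"
proof -
  interpret dissipative_flow "potential k" "\<lambda>r. curvature e r - k" hess "\<chi> i. 1" a
    "frac_calabi_field e k s" r0
  proof (intro dissipative_flow.intro convex_potentialI[OF assms(1)] dissipative_flow_axioms.intro
      continuous_frac_calabi_field frac_dissipative assms(2))
    show "(\<chi> i. 1) \<bullet> frac_calabi_field e k s r = 0" for r
      using orthogonal_range_powr by (simp add: frac_calabi_field_def frac_laplace_def)
  qed
  show ?thesis
  proof (rule converges_exponentially)
    fix R
    \<comment> \<open>The rate is the minimum of the form of the \<open>s\<close>-th power of
      \<open>J\<close> over a ball and the unit sphere of the hyperplane; its existence is where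
      continuity of matrix powers in \<open>r\<close> is used.\<close>
    obtain b where b: "0 < b" "\<And>r v. r \<in> cball a R \<Longrightarrow> (\<chi> i. 1) \<bullet> v = 0 \<Longrightarrow>
        b * (norm v)\<^sup>2 \<le> v \<bullet> (matrix_powr (J e r) s *v v)"
    proof (rule compact_form_bound[of "cball a R" "\<lambda>r v. matrix_powr (J e r) s *v v" "\<chi> i. 1"])
      have "continuous_on UNIV (\<lambda>p. matrix_powr (J e (fst p)) s *v (snd p :: real^'n))"
        by (intro continuous_intros continuous_on_compose2[OF continuous_matrix_powr]) auto
      then show "continuous_on (cball a R \<times> UNIV) (\<lambda>(r, v). matrix_powr (J e r) s *v v)"
        unfolding case_prod_beta by (rule continuous_on_subset) simp
    qed (use powr_pos in auto)
    have "(curvature e r - k) \<bullet> frac_calabi_field e k s r \<le> - b * (norm (curvature e r - k))\<^sup>2"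
      if "r \<in> cball a R" for r
      using b(2)[OF that curvature_defect_sum[of r]] by (simp add: frac_calabi_field_def frac_laplace_def)
    then show "\<exists>b>0. \<forall>r\<in>cball a R.
        (curvature e r - k) \<bullet> frac_calabi_field e k s r \<le> - b * (norm (curvature e r - k))\<^sup>2"
      using b(1) by blast
  qed
qed

text \<open>The dissipation is homogeneous of degree \<open>p\<close> in the defect. For
  \<open>p > 2\<close> it is in general not bounded below near 0 by a multiple of the squared
  defect, so the compactness argument is used and no rate results.\<close>

lemma p_flow_converges:
  assumes "curvature e a = k" and "(\<chi> i. 1) \<bullet> r0 = (\<chi> i. 1) \<bullet> a" and "1 < p"
  shows "flow_converges (p_calabi_field e k p) r0 a"
proof -
  interpret dissipative_flow "potential k" "\<lambda>r. curvature e r - k" hess "\<chi> i. 1" a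
    "p_calabi_field e k p" r0
    by (intro dissipative_flow.intro convex_potentialI[OF assms(1)] dissipative_flow_axioms.intro
      continuous_p_calabi_field assms(2,3))
      (simp_all add: p_calabi_field_def p_laplace_orthogonal p_laplace_dissipative)
  show ?thesis
    by (rule converges)
      (simp add: p_calabi_field_def p_laplace_strictly_dissipative curvature_defect_sum)
qed

lemma frac_limit:
  assumes "flow_converges_exp (frac_calabi_field e k s) r0 a"
  shows "curvature e a = k"
proof (rule ccontr)
  assume "curvature e a \<noteq> k"
  then have "(curvature e a - k) \<bullet> frac_calabi_field e k s a \<noteq> 0"
    using powr_pos[OF _ curvature_defect_sum, of a a s]
    by (simp add: frac_calabi_field_def frac_laplace_def)
  moreover have "frac_calabi_field e k s a = 0"
    using assms continuous_frac_calabi_field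
    by (intro flow_converges_stationary flow_converges_exp_imp_flow_converges)
      (auto simp: continuous_on_eq_continuous_at)
  ultimately show False by simp
qed

lemma p_limit:
  assumes "flow_converges (p_calabi_field e k p) r0 a" "1 < p"
  shows "curvature e a = k"
proof (rule ccontr)
  assume "curvature e a \<noteq> k"
  then have "(curvature e a - k) \<bullet> p_calabi_field e k p a < 0"
    by (simp add: p_calabi_field_def p_laplace_strictly_dissipative curvature_defect_sum)
  moreover have "p_calabi_field e k p a = 0"
    using assms(1) continuous_p_calabi_field[OF assms(2)]
    by (intro flow_converges_stationary) (auto simp: continuous_on_eq_continuous_at)
  ultimately show False by simp
qed

lemma normalized_solution:
  fixes r0 :: "real^'n"
  assumes "curvature e b = k"
  obtains a where "curvature e a = k" "(\<chi> i. 1) \<bullet> r0 = (\<chi> i. 1) \<bullet> a"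
proof
  define c where "c = ((\<Sum>i\<in>UNIV. r0 $ i) - (\<Sum>i\<in>UNIV. b $ i)) / real CARD('n)"
  show "curvature e (b + (\<chi> i. c)) = k" using assms by (simp add: curvature_shift)
  show "(\<chi> i. 1) \<bullet> r0 = (\<chi> i. 1) \<bullet> (b + (\<chi> i. c))"
    by (simp add: inner_vec_def sum.distrib c_def)
qed

end

end

theorem theorem1p7:
  fixes V :: "'v set" and E :: "'v set set" and e :: "'n::finite \<Rightarrow> 'v set"
    and \<kappa>star r0 :: "real^'n"
  assumes "simple_graph V E" and "connected_graph V E" and "girth_at_least_6 E"
    and "bij_betw e UNIV E"
    and "(\<Sum>i\<in>UNIV. \<kappa>star $ i) = 2 * (real (card V) - real (card E))"
  shows "((\<exists>rstar. curvature e rstar = \<kappa>star) \<longleftrightarrow>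
           (\<exists>rstar. flow_converges_exp (calabi_field e \<kappa>star) r0 rstar))
       \<and> ((\<exists>rstar. curvature e rstar = \<kappa>star) \<longleftrightarrow>
           (\<exists>rstar. \<forall>s. flow_converges_exp (frac_calabi_field e \<kappa>star s) r0 rstar))
       \<and> ((\<exists>rstar. curvature e rstar = \<kappa>star) \<longleftrightarrow>
           (\<exists>rstar. \<forall>p>1. flow_converges (p_calabi_field e \<kappa>star p) r0 rstar))
       \<and> (\<forall>rstar. flow_converges_exp (calabi_field e \<kappa>star) r0 rstar
             \<or> (\<exists>s. flow_converges_exp (frac_calabi_field e \<kappa>star s) r0 rstar)
             \<or> (\<exists>p>1. flow_converges (p_calabi_field e \<kappa>star p) r0 rstar)
           \<longrightarrow> curvature e rstar = \<kappa>star)"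
proof -
  interpret edge_enumeration V E e
    using assms by unfold_locales
  note total = assms(5)
  \<comment> \<open>The weight normalized to the sum of \<open>r0\<close> is chosen before
    \<open>s\<close> and \<open>p\<close>, which gives the stronger order of quantifiers.\<close>
  have solvable: "\<exists>a. (\<forall>s. flow_converges_exp (frac_calabi_field e \<kappa>star s) r0 a) \<and>
      (\<forall>p>1. flow_converges (p_calabi_field e \<kappa>star p) r0 a)" if "curvature e b = \<kappa>star" for b
    using normalized_solution[OF total that, of r0] frac_flow_converges[OF total] p_flow_converges[OF total]
    by metis
  \<comment> \<open>A witness such as \<open>p = 2\<close> is needed to draw anything from
    convergence for all \<open>p > 1\<close>.\<close>
  have p: "\<exists>p::real. 1 < p" by (rule exI[of _ 2]) simp
  show ?thesis
    unfolding calabi_field_eq_frac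
    using solvable frac_limit[OF total] p_limit[OF total] p by metis
qed

end
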